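(* Let $0\le a<b\le n$ be fixed. Then for every integer $r$ with $a-b<r\le n-b$, $$\sup_{\gamma\in(a,b]}P(\tilde b_\gamma=b+r)\ \ge\ \begin{cases}\exp\Bigl(-\sum_{m=1}^\infty\frac1m\Bigl(P_F\bigl(\sum_{j=1}^mY_j\ge0\bigr)+P_G\bigl(\sum_{j=1}^mY_j\le0\bigr)\Bigr)\Bigr)&\text{for } r=0,\\[2mm] \int_0^\infty R^+_{F,\infty}(x)\,B^-_{G,-r,\infty}(x)\,dx&\text{for } r<0,\\[2mm] \int_0^\infty R^-_{G,\infty}(x)\,B^+_{F,r,\infty}(x)\,dx&\text{for } r>0,\end{cases}$$ and for every integer $l$ with $-a\le l\le b-a$, $$\sup_{\gamma\in(a,b]}P(\tilde a_\gamma=a+l)\ \ge\ \begin{cases}\exp\Bigl(-\sum_{m=1}^\infty\frac1m\Bigl(P_F\bigl(\sum_{j=1}^mY_j\ge0\bigr)+P_G\bigl(\sum_{j=1}^mY_j\le0\bigr)\Bigr)\Bigr)&\text{for } l=0,\\[2mm] \int_0^\infty R^-_{G,\infty}(x)\,B^+_{F,-l,\infty}(x)\,dx&\text{for } l<0,\\[2mm] \int_0^\infty R^+_{F,\infty}(x)\,B^-_{G,l,\infty}(x)\,dx&\text{for } l>0.\end{cases}$$ The suprema are over integers $\gamma$ with $a<\gamma\le b$.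
   Context: $X_1,\dots,X_n$ are independent, with $X_i\sim G$ for $a<i\le b$ and $X_i\sim F$ otherwise; $P$ denotes the corresponding probability. $F$, $G$ are known distributions with densities $f$, $g$ with respect to a reference measure. $Y_i=\log\frac{g(X_i)}{f(X_i)}$ and $S_t=\sum_{i=1}^tY_i$, $S_0=0$. $P_H$ ($H=F$ or $G$) denotes probability when the observations $X_1,X_2,\dots$ are i.i.d. with distribution $H$. For an integer $\gamma$, put $S^-_{\gamma,i}=S_{\gamma-i}-S_\gamma$ ($0\le i\le\gamma$) and $S^+_{\gamma,i}=S_{\gamma+i}-S_\gamma$ ($0\le i\le n-\gamma$). The local likelihood estimators (LLE) with respect to $\gamma$ are $$\tilde a_\gamma=\gamma-\operatorname*{arg\,min}_{0\le i\le\gamma}S^-_{\gamma,i},\qquad \tilde b_\gamma=\gamma+\operatorname*{arg\,max}_{0\le i\le n-\gamma}S^+_{\gamma,i}.$$ For $k\ge0$, $R^+_{H,k}(x)=P_H(\max(0,S_1,\dots,S_k)<x)$ and $R^-_{H,k}(x)=P_H(\max(0,-S_1,\dots,-S_k)<x)$. For $k,s\ge0$, $$B^+_{H,k,s}(y)\,dy=P_H\bigl(\operatorname*{arg\,max}_{0\le i\le k+s}S_i=k,\ S_k\in[y,y+dy)\bigr),\qquad B^-_{H,k,s}(y)\,dy=P_H\bigl(\operatorname*{arg\,max}_{0\le i\le k+s}(-S_i)=k,\ -S_k\in[y,y+dy)\bigr).$$ An index $\infty$ denotes the limiting quantity: $R^\pm_{H,\infty}$ is the limit of $R^\pm_{H,k}$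 as $k\to\infty$, and $B^\pm_{H,k,\infty}$ is the limit of $B^\pm_{H,k,s}$ as $s\to\infty$ (maxima over all $i\ge0$). *)

theory Defs
  imports "HOL-Probability.Probability"
begin

text \<open>The log-likelihood ratio is real-valued: it is the usual one where \<open>f\<close> and \<open>g\<close> are positive;
  elsewhere (where it would be infinite) it is \<open>0\<close> by the conventions for division and \<open>ln\<close>.\<close>

definition loglik :: "('a \<Rightarrow> real) \<Rightarrow> ('a \<Rightarrow> real) \<Rightarrow> 'a \<Rightarrow> real" where
  "loglik f g x = ln (g x / f x)"

text \<open>Observations are indexed from 1; the coordinate 0 of a path is never used.\<close>

definition walk :: "('a \<Rightarrow> real) \<Rightarrow> (nat \<Rightarrow> 'a) \<Rightarrow> nat \<Rightarrow> real" where
  "walk Y x t = (\<Sum>i=1..t. Y (x i))"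

text \<open>Ties among the maximisers over \<open>{0..k}\<close> are resolved in favour of the smallest index, both in the
  estimators and in the measures \<open>B\<close> below.\<close>

definition argmax_upto :: "nat \<Rightarrow> (nat \<Rightarrow> real) \<Rightarrow> nat" where
  "argmax_upto k h = (LEAST i. is_arg_max h (\<lambda>j. j \<le> k) i)"

definition argmin_upto :: "nat \<Rightarrow> (nat \<Rightarrow> real) \<Rightarrow> nat" where
  "argmin_upto k h = (LEAST i. is_arg_min h (\<lambda>j. j \<le> k) i)"

definition S_minus :: "('a \<Rightarrow> real) \<Rightarrow> (nat \<Rightarrow> 'a) \<Rightarrow> nat \<Rightarrow> nat \<Rightarrow> real" where
  "S_minus Y x \<gamma> i = walk Y x (\<gamma> - i) - walk Y x \<gamma>"

definition S_plus :: "('a \<Rightarrow> real) \<Rightarrow> (nat \<Rightarrow> 'a) \<Rightarrow> nat \<Rightarrow> nat \<Rightarrow> real" where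
  "S_plus Y x \<gamma> i = walk Y x (\<gamma> + i) - walk Y x \<gamma>"

definition a_tilde :: "('a \<Rightarrow> real) \<Rightarrow> (nat \<Rightarrow> 'a) \<Rightarrow> nat \<Rightarrow> nat" where
  "a_tilde Y x \<gamma> = \<gamma> - argmin_upto \<gamma> (S_minus Y x \<gamma>)"

definition b_tilde :: "('a \<Rightarrow> real) \<Rightarrow> nat \<Rightarrow> (nat \<Rightarrow> 'a) \<Rightarrow> nat \<Rightarrow> nat" where
  "b_tilde Y n x \<gamma> = \<gamma> + argmax_upto (n - \<gamma>) (S_plus Y x \<gamma>)"

definition iid :: "'a measure \<Rightarrow> (nat \<Rightarrow> 'a) measure" where
  "iid H = (\<Pi>\<^sub>M i\<in>UNIV. H)"

definition R_plus :: "('a \<Rightarrow> real) \<Rightarrow> 'a measure \<Rightarrow> nat \<Rightarrow> real \<Rightarrow> real" where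
  "R_plus Y H k x =
    measure (iid H) {\<omega> \<in> space (iid H). Max (insert 0 ((\<lambda>i. walk Y \<omega> i) ` {1..k})) < x}"

definition R_minus :: "('a \<Rightarrow> real) \<Rightarrow> 'a measure \<Rightarrow> nat \<Rightarrow> real \<Rightarrow> real" where
  "R_minus Y H k x =
    measure (iid H) {\<omega> \<in> space (iid H). Max (insert 0 ((\<lambda>i. - walk Y \<omega> i) ` {1..k})) < x}"

definition R_plus_inf :: "('a \<Rightarrow> real) \<Rightarrow> 'a measure \<Rightarrow> real \<Rightarrow> real" where
  "R_plus_inf Y H x = lim (\<lambda>k. R_plus Y H k x)"

definition R_minus_inf :: "('a \<Rightarrow> real) \<Rightarrow> 'a measure \<Rightarrow> real \<Rightarrow> real" where
  "R_minus_inf Y H x = lim (\<lambda>k. R_minus Y H k x)"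

text \<open>\<open>B(y) dy\<close> is a sub-probability measure on the reals. It need not have a Lebesgue density,
  so it is kept as a measure and \<open>\<integral> R(x) B(x) dx\<close> is the integral of \<open>R\<close> against it.\<close>

definition B_plus :: "('a \<Rightarrow> real) \<Rightarrow> 'a measure \<Rightarrow> nat \<Rightarrow> nat \<Rightarrow> real measure" where
  "B_plus Y H k s = measure_of UNIV (sets borel) (\<lambda>A.
    emeasure (iid H) {\<omega> \<in> space (iid H).
      argmax_upto (k + s) (\<lambda>i. walk Y \<omega> i) = k \<and> walk Y \<omega> k \<in> A})"

definition B_minus :: "('a \<Rightarrow> real) \<Rightarrow> 'a measure \<Rightarrow> nat \<Rightarrow> nat \<Rightarrow> real measure" where
  "B_minus Y H k s = measure_of UNIV (sets borel) (\<lambda>A.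
    emeasure (iid H) {\<omega> \<in> space (iid H).
      argmax_upto (k + s) (\<lambda>i. - walk Y \<omega> i) = k \<and> - walk Y \<omega> k \<in> A})"

text \<open>The events above decrease in \<open>s\<close>, so the limits exist on every Borel set.\<close>

definition B_plus_inf :: "('a \<Rightarrow> real) \<Rightarrow> 'a measure \<Rightarrow> nat \<Rightarrow> real measure" where
  "B_plus_inf Y H k =
    measure_of UNIV (sets borel) (\<lambda>A. lim (\<lambda>s. emeasure (B_plus Y H k s) A))"

definition B_minus_inf :: "('a \<Rightarrow> real) \<Rightarrow> 'a measure \<Rightarrow> nat \<Rightarrow> real measure" where
  "B_minus_inf Y H k =
    measure_of UNIV (sets borel) (\<lambda>A. lim (\<lambda>s. emeasure (B_minus Y H k s) A))"

text \<open>The exponent series may diverge (e.g. for \<open>F = G\<close>), hence the convention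
  \<open>exp (-\<infinity>) = 0\<close>.\<close>

definition exp_minus :: "ennreal \<Rightarrow> real" where
  "exp_minus s = (if s = \<infinity> then 0 else exp (- enn2real s))"

definition zero_bound :: "('a \<Rightarrow> real) \<Rightarrow> 'a measure \<Rightarrow> 'a measure \<Rightarrow> real" where
  "zero_bound Y F G = exp_minus (\<Sum>k. let m = Suc k in ennreal (1 / real m *
      (measure (iid F) {\<omega> \<in> space (iid F). (\<Sum>j=1..m. Y (\<omega> j)) \<ge> 0}
     + measure (iid G) {\<omega> \<in> space (iid G). (\<Sum>j=1..m. Y (\<omega> j)) \<le> 0})))"

end

theory Submission
  imports Defs
begin

text \<open>
  Write \<open>S\<close> for the random walk of the log-likelihood ratios. Seen from a change-point \<open>c\<close> (\<open>c = a\<close> or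
  \<open>c = b\<close>), the observations up to the other change-point form two independent i.i.d. samples: \<open>X\<^sub>c, X\<^bsub>c-1\<^esub>, \<dots>\<close> with one of the
  distributions \<open>F\<close>, \<open>G\<close> and \<open>X\<^bsub>c+1\<^esub>, X\<^bsub>c+2\<^esub>, \<dots>\<close> with the other. An event about the differences
  \<open>S\<^sub>t - S\<^sub>c\<close> therefore has the same probability under two independent copies of the walk, one running
  backwards and one forwards from \<open>c\<close> (\<open>prob_eq_two_sided\<close>). In each case of the theorem one \<open>\<gamma>\<close> is
  enough to bound the supremum.

  For \<open>r = 0\<close> and \<open>l = 0\<close>, the estimator hits the change-point as soon as the \<open>G\<close>-walk stays strictly
  positive and the \<open>F\<close>-walk stays nonpositive, with \<open>\<gamma> = b\<close> respectively \<open>\<gamma> = a + 1\<close>. It remains to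
  bound the probability that a walk stays nonpositive for \<open>n\<close> steps from below by
  \<open>exp (- (\<Sum>m. P(S\<^sub>m > 0) / m))\<close>, and symmetrically for positive walks. This is Sparre Andersen's
  theorem. Let \<open>u\<^sub>n\<close>, \<open>v\<^sub>n\<close> be the probabilities that \<open>S\<^sub>1, \<dots>, S\<^sub>n\<close> are all positive, all nonpositive,
  and let \<open>L\<^sub>n\<close> be the first index in \<open>0, \<dots>, n\<close> at which the walk is maximal. Looking at the walk
  from \<open>L\<^sub>n\<close>, one finds \<open>P(L\<^sub>n = k) = u\<^sub>k v\<^bsub>n-k\<^esub>\<close>. On the other hand
  \<open>E L\<^sub>n - E L\<^bsub>n-1\<^esub> = P(S\<^sub>n > 0)\<close>: averaged over the \<open>n\<close> cyclic shifts of the increments, the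
  difference \<open>L\<^sub>n - L\<^bsub>n-1\<^esub>\<close> telescopes to \<open>1\<close> if \<open>S\<^sub>n > 0\<close> and to \<open>0\<close> otherwise
  (\<open>sum_window_argmax_diff\<close>). These two facts determine the generating function
  \<open>(1 - x) (\<Sum>n. v\<^sub>n x\<^sup>n) = exp (- (\<Sum>m. P(S\<^sub>m > 0) x\<^sup>m / m))\<close>, and since \<open>v\<close> is decreasing the bound
  follows by letting \<open>x\<close> tend to \<open>1\<close> (\<open>exp_le_of_convolution\<close>).

  In the other cases the integral is, by Fubini's theorem, at most the probability that one walk has
  its first maximum at time \<open>k\<close> and that the other, independent walk stays below the value reached
  there. Replacing the limits over infinite horizons by finite horizons only increases the integral.
  Transported to the two sides of \<open>c\<close>, this event implies that the estimator deviates from \<open>c\<close> by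
  exactly \<open>k\<close> steps to the required side. The tie-breaking conventions of the estimators and of \<open>B\<close> do
  not agree for every \<open>\<gamma>\<close>; they cause no loss when \<open>\<gamma>\<close> is \<open>b + r\<close> for \<open>r < 0\<close>, \<open>b\<close> for \<open>r > 0\<close>,
  \<open>a + 1\<close> for \<open>l < 0\<close> and \<open>a + l\<close> for \<open>l > 0\<close>.
\<close>

section \<open>The first maximiser of a finite sequence\<close>

lemma argmax_upto_eq_iff:
  "argmax_upto k h = m \<longleftrightarrow>
     m \<le> k \<and> (\<forall>i<m. h i < h m) \<and> (\<forall>i. m < i \<and> i \<le> k \<longrightarrow> h i \<le> h m)"
proof -
  have first: "m \<le> k \<and> (\<forall>i<m. h i < h m) \<and> (\<forall>i. m < i \<and> i \<le> k \<longrightarrow> h i \<le> h m)"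
    if m: "m = argmax_upto k h" for m
  proof -
    have "Max (h ` {..k}) \<in> h ` {..k}"
      by (intro Max_in) auto
    then obtain p where p: "p \<le> k" "h p = Max (h ` {..k})"
      by (metis (no_types, lifting) atMost_iff imageE)
    have "is_arg_max h (\<lambda>j. j \<le> k) p"
      using p by (auto simp: is_arg_max_def not_less)
    then have max_m: "is_arg_max h (\<lambda>j. j \<le> k) m"
      unfolding m argmax_upto_def by (rule LeastI)
    moreover have "\<not> is_arg_max h (\<lambda>j. j \<le> k) i" if "i < m" for i
      using that unfolding m argmax_upto_def by (rule not_less_Least)
    ultimately show ?thesis
      unfolding is_arg_max_def
      by (metis linorder_not_less order.trans less_imp_le order.strict_trans1)
  qed
  show ?thesis
    using first[OF refl] by (metis linorder_not_le linorder_neqE_nat)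
qed

lemma argmax_upto_le: "argmax_upto k h \<le> k"
  using argmax_upto_eq_iff[of k h "argmax_upto k h"] by simp

lemma argmin_upto_eq_argmax_upto: "argmin_upto k h = argmax_upto k (\<lambda>i. - h i)"
  for h :: "nat \<Rightarrow> real"
  unfolding argmin_upto_def argmax_upto_def is_arg_max_def is_arg_min_def by simp

lemma argmax_upto_cong:
  assumes "\<And>i. i \<le> k \<Longrightarrow> h i = h' i"
  shows "argmax_upto k h = argmax_upto k h'"
  using argmax_upto_eq_iff[of k h "argmax_upto k h'"] argmax_upto_eq_iff[of k h' "argmax_upto k h'"]
    assms by simp

lemma argmax_upto_shift: "argmax_upto n (\<lambda>i. h i - c) = argmax_upto n h" for c :: real
  by (simp add: argmax_upto_def is_arg_max_def)

text \<open>If the last value exceeds the first, the first index can be dropped from the range; otherwise the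
  last one can (\<open>argmax_upto_Suc_0_ge\<close>).\<close>

lemma argmax_upto_Suc_0_less:
  assumes "h 0 < h (Suc k)"
  shows "argmax_upto (Suc k) h = Suc (argmax_upto k (\<lambda>i. h (Suc i)))"
proof -
  define m where "m = argmax_upto k (\<lambda>i. h (Suc i))"
  have m: "m \<le> k" "\<And>i. i < m \<Longrightarrow> h (Suc i) < h (Suc m)"
    "\<And>i. m < i \<Longrightarrow> i \<le> k \<Longrightarrow> h (Suc i) \<le> h (Suc m)"
    using argmax_upto_eq_iff[of k "\<lambda>i. h (Suc i)" m] m_def by auto
  have "h (Suc k) \<le> h (Suc m)"
    using m(1) m(3)[of k] by (cases "m = k") auto
  then have "h i < h (Suc m)" if "i < Suc m" for i
    using assms m(2) that by (cases i) auto
  moreover have "h i \<le> h (Suc m)" if "Suc m < i" "i \<le> Suc k" for i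
    using m(3)[of "i - 1"] that by (cases i) auto
  ultimately show ?thesis
    unfolding m_def[symmetric] argmax_upto_eq_iff using m(1) by auto
qed

lemma argmax_upto_Suc_0_ge:
  assumes "h (Suc k) \<le> h 0"
  shows "argmax_upto (Suc k) h = argmax_upto k h"
proof -
  define m where "m = argmax_upto k h"
  have m: "m \<le> k" "\<And>i. i < m \<Longrightarrow> h i < h m" "\<And>i. m < i \<Longrightarrow> i \<le> k \<Longrightarrow> h i \<le> h m"
    using argmax_upto_eq_iff[of k h m] m_def by auto
  have "h (Suc k) \<le> h m"
    using assms m(2)[of 0] by (cases "m = 0") auto
  then show ?thesis
    unfolding m_def[symmetric] argmax_upto_eq_iff using m by (auto simp: le_Suc_eq)
qed

text \<open>
  Let \<open>s\<close> have periodic increments with period \<open>N = n + 1\<close>, so that the windows starting at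
  \<open>j = 0, \<dots>, n\<close> run through the cyclic shifts of one cycle. The position of the first maximum over
  \<open>{j..j + N}\<close> and over \<open>{j..j + N - 1}\<close> agree if \<open>c \<le> 0\<close>. If \<open>c > 0\<close>, then \<open>s j < s (j + N)\<close> and the
  former is also the position over \<open>{j + 1..j + N}\<close>, so that the differences telescope.
\<close>

lemma sum_window_argmax_diff:
  fixes s :: "nat \<Rightarrow> real"
  assumes per: "\<And>i. s (i + Suc n) = s i + c"
  shows "(\<Sum>j<Suc n. real (argmax_upto (Suc n) (\<lambda>i. s (j + i))) - real (argmax_upto n (\<lambda>i. s (j + i))))
           = (if 0 < c then real (Suc n) else 0)"
proof -
  define l where "l j = real (argmax_upto n (\<lambda>i. s (j + i)))" for j
  have step: "real (argmax_upto (Suc n) (\<lambda>i. s (j + i))) = (if 0 < c then l (Suc j) + 1 else l j)" for j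
    using argmax_upto_Suc_0_less[of "\<lambda>i. s (j + i)" n] argmax_upto_Suc_0_ge[of "\<lambda>i. s (j + i)" n] per[of j]
    by (auto simp: l_def)
  have "argmax_upto n (\<lambda>i. s (Suc n + i)) = argmax_upto n s"
    using argmax_upto_eq_iff[of n s "argmax_upto n s"] per
    by (simp add: argmax_upto_eq_iff add.commute[of n])
  then have "l (Suc n) = l 0"
    by (simp add: l_def)
  then have "(\<Sum>j<Suc n. l (Suc j) - l j) = 0"
    by (simp only: sum_lessThan_telescope)
  then have "(\<Sum>j<Suc n. l (Suc j) + 1 - l j) = real (Suc n)"
    by (simp add: sum.distrib sum_subtractf del: sum.lessThan_Suc)
  then show ?thesis
    unfolding step l_def[symmetric] by (auto simp del: sum.lessThan_Suc)
qed

section \<open>A lower bound from generating functions\<close>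

lemma fps_conv_radius_ge_1:
  fixes f :: "real fps"
  assumes "\<And>n. \<bar>fps_nth f n\<bar> \<le> 1"
  shows "1 \<le> fps_conv_radius f"
  unfolding fps_conv_radius_def
proof (rule conv_radius_geI_ex')
  fix r :: real
  assume r: "0 < r" "ereal r < 1"
  show "summable (\<lambda>n. fps_nth f n * of_real r ^ n)"
  proof (rule summable_comparison_test')
    show "summable (\<lambda>n. r ^ n)"
      using r by (intro summable_geometric) auto
    show "norm (fps_nth f n * of_real r ^ n) \<le> r ^ n" for n
      using r assms[of n] by (simp add: abs_mult power_abs mult_left_le_one_le)
  qed
qed

text \<open>The equation \<open>W' = - E' W\<close> of formal power series is solved by \<open>exp (- E)\<close> on the unit interval.\<close>

lemma eval_fps_eq_exp:
  fixes W E Q :: "real fps"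
  assumes conv: "1 \<le> fps_conv_radius W" "1 \<le> fps_conv_radius E" "1 \<le> fps_conv_radius Q"
    and W: "fps_deriv W = - (Q * W)" "fps_nth W 0 = 1"
    and E: "fps_deriv E = Q" "fps_nth E 0 = 0"
    and x: "0 \<le> x" "x < 1"
  shows "eval_fps W x = exp (- eval_fps E x)"
proof -
  have in_disc: "z \<in> eball 0 (fps_conv_radius f)" if "\<bar>z\<bar> < 1" "1 \<le> fps_conv_radius f"
    for f :: "real fps" and z :: real
  proof -
    have "ereal \<bar>z\<bar> < 1" using that by simp
    then have "ereal \<bar>z\<bar> < fps_conv_radius f" using that(2) by (rule less_le_trans)
    then show ?thesis by simp
  qed
  have "((\<lambda>x. eval_fps W x * exp (eval_fps E x)) has_real_derivative 0) (at z within {-1<..<1})"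
    if "z \<in> {-1<..<1}" for z
  proof -
    have "\<bar>z\<bar> < 1" using that by auto
    then have z: "z \<in> eball 0 (fps_conv_radius W)" "z \<in> eball 0 (fps_conv_radius E)"
      "z \<in> eball 0 (fps_conv_radius Q)"
      using conv in_disc by blast+
    have "eval_fps (fps_deriv W) z = - (eval_fps Q z * eval_fps W z)"
      using z by (simp add: W eval_fps_minus eval_fps_mult less_le_trans[OF _ fps_conv_radius_mult])
    then show ?thesis
      using z
      by (auto intro!: derivative_eq_intros has_field_derivative_eval_fps simp: E algebra_simps)
  qed
  then obtain c where "\<forall>z\<in>{-1<..<1}. eval_fps W z * exp (eval_fps E z) = c"
    using has_field_derivative_zero_constant[of "{-1<..<1::real}"] by blast
  then have "eval_fps W x * exp (eval_fps E x) = eval_fps W 0 * exp (eval_fps E 0)"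
    using x by simp
  then show ?thesis
    by (simp add: eval_fps_at_0 W E exp_minus field_simps)
qed

text \<open>
  In terms of the generating functions \<open>U\<close>, \<open>V\<close> of \<open>u\<close>, \<open>v\<close> the assumptions are \<open>U V = 1 / (1 - X)\<close> and
  \<open>X U' V = (\<Sum>m. q\<^sub>m X\<^sup>m) / (1 - X)\<close>. They imply \<open>W' = - Q W\<close> for \<open>W = (1 - X) V\<close> and
  \<open>Q = (\<Sum>m. q\<^bsub>m+1\<^esub> X\<^sup>m)\<close>. As \<open>v\<close> is decreasing, all coefficients of \<open>W\<close> but the first are nonpositive.
\<close>

lemma exp_le_of_convolution:
  fixes u v q :: "nat \<Rightarrow> real"
  assumes v: "v 0 = 1" "decseq v" "\<And>n. 0 \<le> v n"
    and conv: "\<And>n. (\<Sum>k\<le>n. u k * v (n - k)) = 1"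
    and mean: "\<And>n. (\<Sum>k\<le>n. real k * u k * v (n - k)) = (\<Sum>k<n. q (Suc k))"
    and q: "\<And>k. 0 \<le> q k" "\<And>k. q k \<le> 1"
    and summable: "summable (\<lambda>k. q (Suc k) / real (Suc k))"
  shows "exp (- (\<Sum>k. q (Suc k) / real (Suc k))) \<le> v N"
proof -
  define U V G W Q E where "U = Abs_fps u" and "V = Abs_fps v" and "G = (Abs_fps (\<lambda>_. 1) :: real fps)"
    and "W = (1 - fps_X) * V" and "Q = Abs_fps (\<lambda>k. q (Suc k))"
    and "E = fps_integral0 Q"
  have G: "G * (1 - fps_X) = 1"
    using inverse_mult_eq_1'[of G] by (simp add: G_def fps_inverse_gp')
  have UV: "U * V = G"
    by (rule fps_ext) (simp add: U_def V_def G_def fps_mult_nth conv atLeast0AtMost)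
  then have UW: "U * W = 1"
    using G by (metis W_def mult.assoc mult.commute)
  have "fps_X * fps_deriv U * V = fps_X * Q * G"
  proof (rule fps_ext)
    fix n
    have "fps_nth (fps_X * fps_deriv U) k = real k * u k" for k
      by (cases k) (simp_all add: U_def)
    then have "fps_nth (fps_X * fps_deriv U * V) n = (\<Sum>k<n. q (Suc k))"
      by (simp add: fps_mult_nth V_def atLeast0AtMost mean mult.assoc[symmetric])
    also have "\<dots> = fps_nth (fps_X * (Q * G)) n"
    proof -
      have "fps_nth (Q * G) m = (\<Sum>k\<le>m. q (Suc k))" for m
        by (simp add: fps_mult_nth Q_def G_def atLeast0AtMost)
      then show ?thesis
        by (cases n) (simp_all add: lessThan_Suc_atMost)
    qed
    finally show "fps_nth (fps_X * fps_deriv U * V) n = fps_nth (fps_X * Q * G) n"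
      by (simp add: mult.assoc)
  qed
  then have "fps_deriv U * V = Q * G"
    by (simp add: mult.assoc)
  then have "fps_deriv U * W = Q"
    using G by (simp add: W_def mult.left_commute[of _ "1 - fps_X"] mult.commute[of G])
  moreover have "fps_deriv U * W + U * fps_deriv W = 0"
    using arg_cong[OF UW, of fps_deriv] by (simp add: add.commute)
  ultimately have "U * fps_deriv W = - Q"
    by (simp add: add_eq_0_iff)
  then have deriv_W: "fps_deriv W = - (Q * W)"
  proof -
    have "fps_deriv W = (U * fps_deriv W) * W"
      using UW by (simp add: mult.assoc mult.left_commute[of U] mult.commute[of _ W])
    then show ?thesis
      by (simp add: \<open>U * fps_deriv W = - Q\<close>)
  qed
  have W_0: "fps_nth W 0 = 1" and W_Suc: "fps_nth W (Suc n) = v (Suc n) - v n" for n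
    using v by (simp_all add: W_def V_def algebra_simps)
  have E_0: "fps_nth E 0 = 0" and E_Suc: "fps_nth E (Suc n) = q (Suc n) / real (Suc n)" for n
    by (simp_all add: E_def Q_def fps_integral_def field_simps)
  have v_le: "v n \<le> 1" and v_Suc: "v (Suc n) \<le> v n" for n
    using v decseqD[of v 0 n] decseq_Suc_iff by auto
  have "fps_deriv E = Q"
    by (simp add: E_def fps_deriv_fps_integral)
  have conv_W: "1 \<le> fps_conv_radius W"
  proof (rule fps_conv_radius_ge_1)
    show "\<bar>fps_nth W n\<bar> \<le> 1" for n
      using v(3)[of n] v(3)[of "n - 1"] v_le[of n] v_le[of "n - 1"]
      by (cases n) (auto simp: W_0 W_Suc)
  qed
  have conv_E: "1 \<le> fps_conv_radius E"
  proof (rule fps_conv_radius_ge_1)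
    show "\<bar>fps_nth E n\<bar> \<le> 1" for n
      using q[of n] by (cases n) (auto simp: E_0 E_Suc divide_le_eq order_trans[of _ 1])
  qed
  have conv_Q: "1 \<le> fps_conv_radius Q"
    using q by (intro fps_conv_radius_ge_1) (simp add: Q_def)
  define C where "C = exp (- (\<Sum>k. q (Suc k) / real (Suc k)))"
  \<comment> \<open>A partial sum of the nonnegative series \<open>1 - W(x)\<close>; at \<open>x = 1\<close> it telescopes to \<open>1 - v N\<close>.\<close>
  have bound: "(\<Sum>n<N. (v n - v (Suc n)) * x ^ Suc n) \<le> 1 - C" if x: "0 < x" "x < 1" for x
  proof -
    have "summable (\<lambda>n. fps_nth W n * x ^ n)" "summable (\<lambda>n. fps_nth E n * x ^ n)"
      using x conv_W conv_E by (auto intro!: summable_fps simp: less_le_trans[of _ 1])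
    then have sW: "(\<lambda>n. (v (Suc n) - v n) * x ^ Suc n) sums (eval_fps W x - 1)"
      and sE: "(\<lambda>n. q (Suc n) / real (Suc n) * x ^ Suc n) sums eval_fps E x"
      using sums_Suc_iff[of "\<lambda>n. fps_nth W n * x ^ n"] sums_Suc_iff[of "\<lambda>n. fps_nth E n * x ^ n"]
      by (auto simp: eval_fps_def W_0 W_Suc E_0 E_Suc summable_sums simp del: power_Suc)
    have "eval_fps E x \<le> (\<Sum>k. q (Suc k) / real (Suc k))"
    proof (rule sums_le[OF _ sE summable_sums[OF summable]])
      show "q (Suc n) / real (Suc n) * x ^ Suc n \<le> q (Suc n) / real (Suc n)" for n
        using q(1) x by (intro mult_right_le_one_le power_le_one) auto
    qed
    then have "C \<le> eval_fps W x"
      using x eval_fps_eq_exp[OF conv_W conv_E conv_Q deriv_W W_0 \<open>fps_deriv E = Q\<close> E_0, of x]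
      by (simp add: C_def)
    moreover have "(\<Sum>n<N. (v n - v (Suc n)) * x ^ Suc n) \<le> 1 - eval_fps W x"
    proof -
      have sums: "(\<lambda>n. (v n - v (Suc n)) * x ^ Suc n) sums (1 - eval_fps W x)"
        using sums_minus[OF sW] by (simp add: minus_mult_left del: power_Suc)
      have "(\<Sum>n<N. (v n - v (Suc n)) * x ^ Suc n) \<le> (\<Sum>n. (v n - v (Suc n)) * x ^ Suc n)"
        using v_Suc x by (intro sum_le_suminf sums_summable[OF sums]) auto
      then show ?thesis
        using sums_unique[OF sums] by simp
    qed
    ultimately show ?thesis by simp
  qed
  have "((\<lambda>x. \<Sum>n<N. (v n - v (Suc n)) * x ^ Suc n) \<longlongrightarrow> (\<Sum>n<N. (v n - v (Suc n)) * 1 ^ Suc n)) (at_left 1)"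
    by (intro tendsto_intros)
  moreover have "eventually (\<lambda>x. (\<Sum>n<N. (v n - v (Suc n)) * x ^ Suc n) \<le> 1 - C) (at_left 1)"
    by (rule eventually_mono[OF eventually_at_left_real[of 0 1]]) (auto intro!: bound simp del: power_Suc)
  ultimately have "(\<Sum>n<N. (v n - v (Suc n)) * 1 ^ Suc n) \<le> 1 - C"
    by (rule tendsto_upperbound) simp
  moreover have "(\<Sum>n<N. v n - v (Suc n)) = 1 - v N"
    using sum_lessThan_telescope'[of v N] v by simp
  ultimately show ?thesis
    by (simp add: C_def)
qed

section \<open>The mean position of the first maximum of a random walk\<close>

lemma prob_space_iid: "prob_space H \<Longrightarrow> prob_space (iid H)"
  unfolding iid_def by (rule prob_space_PiM)

lemma measurable_walk:
  assumes "Y \<in> borel_measurable H" "{1..t} \<subseteq> I"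
  shows "(\<lambda>x. walk Y x t) \<in> borel_measurable (\<Pi>\<^sub>M i\<in>I. H)"
  unfolding walk_def using assms by (intro borel_measurable_sum) (auto intro!: measurable_compose[OF measurable_component_singleton])

lemma measurable_walk_iid [measurable]:
  assumes [measurable]: "Y \<in> borel_measurable H"
  shows "(\<lambda>x. walk Y x t) \<in> borel_measurable (iid H)"
  unfolding iid_def by (rule measurable_walk) auto

lemma measurable_argmax_upto:
  assumes "\<And>i. i \<le> k \<Longrightarrow> (\<lambda>\<omega>. h \<omega> i) \<in> borel_measurable M"
  shows "(\<lambda>\<omega>. argmax_upto k (h \<omega>)) \<in> measurable M (count_space UNIV)"
proof -
  define h' where "h' \<omega> i = h \<omega> (min i k)" for \<omega> i
  have [measurable]: "(\<lambda>\<omega>. h' \<omega> i) \<in> borel_measurable M" for i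
    unfolding h'_def using assms by simp
  have eq: "argmax_upto k (h \<omega>) = argmax_upto k (h' \<omega>)" for \<omega>
    by (rule argmax_upto_cong) (simp add: h'_def)
  have "(\<lambda>\<omega>. argmax_upto k (h' \<omega>)) -` {m} \<inter> space M \<in> sets M" for m
  proof -
    have "(\<lambda>\<omega>. argmax_upto k (h' \<omega>)) -` {m} \<inter> space M = {\<omega> \<in> space M.
       m \<le> k \<and> (\<forall>i<m. h' \<omega> i < h' \<omega> m) \<and> (\<forall>i. m < i \<and> i \<le> k \<longrightarrow> h' \<omega> i \<le> h' \<omega> m)}"
      unfolding argmax_upto_eq_iff[symmetric] by auto
    also have "\<dots> \<in> sets M"
      by measurable
    finally show ?thesis .
  qed
  then show ?thesis
    unfolding measurable_count_space_eq2_countable eq by simp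
qed

lemma distr_iid_reindex:
  assumes "prob_space H" "inj \<pi>"
  shows "distr (iid H) (iid H) (\<lambda>\<omega> i. \<omega> (\<pi> i)) = iid H"
  using distr_PiM_reindex[of UNIV "\<lambda>_. H" \<pi> UNIV] assms by (simp add: iid_def restrict_def)

lemma add_mod_cancel:
  fixes x y j N :: nat
  assumes "(x + j) mod N = (y + j) mod N" "x < N" "y < N"
  shows "x = y"
  using assms
proof (induction x y rule: linorder_wlog)
  case (le x y)
  then have "N dvd (y + j) - (x + j)"
    by (intro mod_eq_dvd_iff_nat[THEN iffD1]) auto
  then show ?case
    using le nat_dvd_not_less[of "y - x" N] by (cases "x = y") auto
qed auto

text \<open>The joint law of the increments is invariant under cyclic shifts of the first \<open>n + 1\<close> of them, so
  the mean can be averaged over these shifts, where \<open>sum_window_argmax_diff\<close> applies.\<close>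

lemma integral_argmax_upto_Suc:
  assumes "prob_space H" and [measurable]: "Y \<in> borel_measurable H"
  shows "(\<integral>\<omega>. real (argmax_upto (Suc n) (walk Y \<omega>)) \<partial>iid H)
       = (\<integral>\<omega>. real (argmax_upto n (walk Y \<omega>)) \<partial>iid H)
         + measure (iid H) {\<omega> \<in> space (iid H). 0 < walk Y \<omega> (Suc n)}"
proof -
  interpret H: prob_space "iid H"
    using assms(1) by (rule prob_space_iid)
  define D where "D \<omega> = real (argmax_upto (Suc n) (walk Y \<omega>)) - real (argmax_upto n (walk Y \<omega>))" for \<omega>
  \<comment> \<open>The shift by \<open>j\<close> of the indices \<open>1, \<dots>, n + 1\<close>; the other coordinates stay in place.\<close>
  define \<pi> where "\<pi> j i = (if i \<in> {1..Suc n} then Suc ((i - 1 + j) mod Suc n) else i)" for j i :: nat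
  have arg_meas [measurable]: "(\<lambda>\<omega>. argmax_upto k (walk Y \<omega>)) \<in> measurable (iid H) (count_space UNIV)" for k
    by (rule measurable_argmax_upto) measurable
  have int: "integrable (iid H) (\<lambda>\<omega>. real (argmax_upto k (walk Y \<omega>)))" for k
    by (rule H.integrable_const_bound[of _ k]) (auto simp: argmax_upto_le)
  have int_D: "integrable (iid H) D"
    unfolding D_def using int by (intro Bochner_Integration.integrable_diff)
  have inj: "inj (\<pi> j)" for j
  proof (rule injI)
    fix x y assume eq: "\<pi> j x = \<pi> j y"
    have range: "\<pi> j i \<in> {1..Suc n} \<longleftrightarrow> i \<in> {1..Suc n}" for i
      by (auto simp: \<pi>_def less_Suc_eq_le[symmetric])
    show "x = y"
    proof (cases "x \<in> {1..Suc n}")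
      case True
      then have "y \<in> {1..Suc n}"
        using range eq by metis
      then have "(x - 1 + j) mod Suc n = (y - 1 + j) mod Suc n"
        using eq True by (simp add: \<pi>_def)
      then have "x - 1 = y - 1"
        by (rule add_mod_cancel) (use True \<open>y \<in> {1..Suc n}\<close> in auto)
      then show ?thesis
        using True \<open>y \<in> {1..Suc n}\<close> by auto
    next
      case False
      then have "y \<notin> {1..Suc n}"
        using range eq by metis
      then show ?thesis
        using eq False by (simp only: \<pi>_def if_False)
    qed
  qed
  have shift: "(\<integral>\<omega>. D (\<lambda>i. \<omega> (\<pi> j i)) \<partial>iid H) = (\<integral>\<omega>. D \<omega> \<partial>iid H)"
    and int_shift: "integrable (iid H) (\<lambda>\<omega>. D (\<lambda>i. \<omega> (\<pi> j i)))" for j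
  proof -
    have meas: "(\<lambda>\<omega> i. \<omega> (\<pi> j i)) \<in> measurable (iid H) (iid H)"
      unfolding iid_def by (rule measurable_PiM_single') (auto simp: space_PiM)
    show "(\<integral>\<omega>. D (\<lambda>i. \<omega> (\<pi> j i)) \<partial>iid H) = (\<integral>\<omega>. D \<omega> \<partial>iid H)"
      using integral_distr[OF meas, of D] int_D distr_iid_reindex[OF assms(1) inj[of j]] by simp
    show "integrable (iid H) (\<lambda>\<omega>. D (\<lambda>i. \<omega> (\<pi> j i)))"
      using integrable_distr[OF meas, of D] int_D distr_iid_reindex[OF assms(1) inj[of j]] by simp
  qed
  have cyc: "(\<Sum>j<Suc n. D (\<lambda>i. \<omega> (\<pi> j i))) = real (Suc n) * indicator {\<omega>. 0 < walk Y \<omega> (Suc n)} \<omega>" for \<omega>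
  proof -
    \<comment> \<open>The walk whose increments repeat the first \<open>n + 1\<close> increments periodically.\<close>
    define s where "s t = (\<Sum>i<t. Y (\<omega> (Suc (i mod Suc n))))" for t
    have s_add: "s (j + t) = s j + (\<Sum>i<t. Y (\<omega> (Suc ((j + i) mod Suc n))))" for j t
      by (induction t) (simp_all add: s_def)
    have walk_shift: "walk Y (\<lambda>i. \<omega> (\<pi> j i)) t = s (j + t) - s j" if "t \<le> Suc n" for j t
    proof -
      have "walk Y (\<lambda>i. \<omega> (\<pi> j i)) t = (\<Sum>i<t. Y (\<omega> (\<pi> j (Suc i))))"
        by (simp add: walk_def sum.atLeast1_atMost_eq)
      also have "\<dots> = (\<Sum>i<t. Y (\<omega> (Suc ((j + i) mod Suc n))))"
        using that by (intro sum.cong) (auto simp: \<pi>_def add.commute)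
      finally show ?thesis
        by (simp add: s_add)
    qed
    have s_Suc: "s (Suc n) = walk Y \<omega> (Suc n)"
      by (simp add: s_def walk_def sum.atLeast1_atMost_eq)
    have "s (i + Suc n) = s i + walk Y \<omega> (Suc n)" for i
      unfolding add.commute[of i] s_add mod_add_self1 s_Suc by (simp add: s_def)
    then have "(\<Sum>j<Suc n. real (argmax_upto (Suc n) (\<lambda>i. s (j + i))) - real (argmax_upto n (\<lambda>i. s (j + i))))
                 = (if 0 < walk Y \<omega> (Suc n) then real (Suc n) else 0)"
      by (rule sum_window_argmax_diff)
    moreover have "argmax_upto k (walk Y (\<lambda>i. \<omega> (\<pi> j i))) = argmax_upto k (\<lambda>i. s (j + i))" if "k \<le> Suc n" for k j
    proof -
      have "argmax_upto k (walk Y (\<lambda>i. \<omega> (\<pi> j i))) = argmax_upto k (\<lambda>i. s (j + i) - s j)"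
        using that walk_shift by (intro argmax_upto_cong) auto
      also have "\<dots> = argmax_upto k (\<lambda>i. s (j + i))"
        by (rule argmax_upto_shift)
      finally show ?thesis .
    qed
    ultimately show ?thesis
      by (simp add: D_def del: sum.lessThan_Suc)
  qed
  have "real (Suc n) * (\<integral>\<omega>. D \<omega> \<partial>iid H) = (\<Sum>j<Suc n. \<integral>\<omega>. D (\<lambda>i. \<omega> (\<pi> j i)) \<partial>iid H)"
    by (simp only: shift sum_constant card_lessThan)
  also have "\<dots> = (\<integral>\<omega>. (\<Sum>j<Suc n. D (\<lambda>i. \<omega> (\<pi> j i))) \<partial>iid H)"
    using int_shift by (intro Bochner_Integration.integral_sum[symmetric])
  also have "\<dots> = real (Suc n) * measure (iid H) {\<omega> \<in> space (iid H). 0 < walk Y \<omega> (Suc n)}"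
    unfolding cyc by (simp add: Int_def conj_commute)
  finally have "(\<integral>\<omega>. D \<omega> \<partial>iid H) = measure (iid H) {\<omega> \<in> space (iid H). 0 < walk Y \<omega> (Suc n)}"
    by simp
  then show ?thesis
    using int by (simp add: D_def)
qed

section \<open>The walk seen from a change-point\<close>

lemma distr_PiM_two_sided:
  fixes lo c hi :: nat
  assumes H: "prob_space H1" "prob_space H2" and le: "lo \<le> c" "c \<le> hi"
  shows "distr (\<Pi>\<^sub>M i\<in>{lo<..hi}. if i \<le> c then H1 else H2)
      ((\<Pi>\<^sub>M i\<in>{1..c - lo}. H1) \<Otimes>\<^sub>M (\<Pi>\<^sub>M i\<in>{1..hi - c}. H2))
      (\<lambda>z. (\<lambda>j\<in>{1..c - lo}. z (Suc c - j), \<lambda>j\<in>{1..hi - c}. z (c + j)))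
    = (\<Pi>\<^sub>M i\<in>{1..c - lo}. H1) \<Otimes>\<^sub>M (\<Pi>\<^sub>M i\<in>{1..hi - c}. H2)"
proof -
  define H where "H i = (if i \<le> c then H1 else H2)" for i
  define I J where "I = {lo<..c}" and "J = {c<..hi}"
  have IJ: "I \<inter> J = {}" "finite I" "finite J" and un: "I \<union> J = {lo<..hi}"
    using le by (auto simp: I_def J_def)
  have prob_H: "prob_space (H i)" for i
    using H by (simp add: H_def)
  interpret product_prob_space H UNIV
    by (rule product_prob_spaceI) (rule prob_H)
  define \<phi>1 where "\<phi>1 z = (\<lambda>j\<in>{1..c - lo}. z (Suc c - j))" for z :: "nat \<Rightarrow> 'a"
  define \<phi>2 where "\<phi>2 z = (\<lambda>j\<in>{1..hi - c}. z (c + j))" for z :: "nat \<Rightarrow> 'a"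
  let ?M1 = "\<Pi>\<^sub>M i\<in>{1..c - lo}. H1" and ?M2 = "\<Pi>\<^sub>M i\<in>{1..hi - c}. H2"
  have M1: "(\<Pi>\<^sub>M j\<in>{1..c - lo}. H (Suc c - j)) = ?M1"
    by (rule PiM_cong) (auto simp: H_def)
  have M2: "(\<Pi>\<^sub>M j\<in>{1..hi - c}. H (c + j)) = ?M2"
    by (rule PiM_cong) (auto simp: H_def)
  have \<phi>1: "distr (PiM I H) ?M1 \<phi>1 = ?M1" "\<phi>1 \<in> measurable (PiM I H) ?M1"
  proof -
    show "distr (PiM I H) ?M1 \<phi>1 = ?M1"
      unfolding M1[symmetric] \<phi>1_def[abs_def] using prob_H
      by (intro distr_PiM_reindex inj_onI) (auto simp: I_def)
    show "\<phi>1 \<in> measurable (PiM I H) ?M1"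
      unfolding M1[symmetric] \<phi>1_def
      by (intro measurable_restrict measurable_component_singleton) (auto simp: I_def)
  qed
  have \<phi>2: "distr (PiM J H) ?M2 \<phi>2 = ?M2" "\<phi>2 \<in> measurable (PiM J H) ?M2"
  proof -
    show "distr (PiM J H) ?M2 \<phi>2 = ?M2"
      unfolding M2[symmetric] \<phi>2_def[abs_def] using prob_H
      by (intro distr_PiM_reindex inj_onI) (auto simp: J_def)
    show "\<phi>2 \<in> measurable (PiM J H) ?M2"
      unfolding M2[symmetric] \<phi>2_def
      by (intro measurable_restrict measurable_component_singleton) (auto simp: J_def)
  qed
  have \<phi>: "(\<lambda>z. (\<phi>1 z, \<phi>2 z)) \<in> measurable (PiM (I \<union> J) H) (?M1 \<Otimes>\<^sub>M ?M2)"
    unfolding M1[symmetric] M2[symmetric] \<phi>1_def \<phi>2_def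
    by (intro measurable_Pair measurable_restrict measurable_component_singleton) (auto simp: I_def J_def)
  have \<phi>_merge: "\<phi>1 (merge I J (x, y)) = \<phi>1 x" "\<phi>2 (merge I J (x, y)) = \<phi>2 y" for x y
    using le by (auto simp: \<phi>1_def \<phi>2_def merge_def I_def J_def fun_eq_iff)
  have "distr (PiM (I \<union> J) H) (?M1 \<Otimes>\<^sub>M ?M2) (\<lambda>z. (\<phi>1 z, \<phi>2 z))
      = distr (distr (PiM I H \<Otimes>\<^sub>M PiM J H) (PiM (I \<union> J) H) (merge I J)) (?M1 \<Otimes>\<^sub>M ?M2) (\<lambda>z. (\<phi>1 z, \<phi>2 z))"
    using IJ by (simp add: distr_merge)
  also have "\<dots> = distr (PiM I H \<Otimes>\<^sub>M PiM J H) (?M1 \<Otimes>\<^sub>M ?M2) (\<lambda>(x, y). (\<phi>1 x, \<phi>2 y))"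
    by (subst distr_distr[OF \<phi> measurable_merge]) (intro distr_cong, auto simp: \<phi>_merge)
  also have "\<dots> = distr (PiM I H) ?M1 \<phi>1 \<Otimes>\<^sub>M distr (PiM J H) ?M2 \<phi>2"
  proof (rule pair_measure_distr[symmetric, OF \<phi>1(2) \<phi>2(2)])
    show "sigma_finite_measure (distr (PiM J H) ?M2 \<phi>2)"
      unfolding \<phi>2(1) using H by (intro prob_space_imp_sigma_finite prob_space_PiM)
  qed
  finally have "distr (PiM {lo<..hi} H) (?M1 \<Otimes>\<^sub>M ?M2) (\<lambda>z. (\<phi>1 z, \<phi>2 z)) = ?M1 \<Otimes>\<^sub>M ?M2"
    by (simp only: \<phi>1(1) \<phi>2(1) un)
  then show ?thesis
    unfolding H_def \<phi>1_def \<phi>2_def .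
qed

lemma distr_iid_restrict:
  assumes "prob_space H"
  shows "distr (iid H) (\<Pi>\<^sub>M i\<in>J. H) (\<lambda>\<omega>. restrict \<omega> J) = (\<Pi>\<^sub>M i\<in>J. H)"
  using distr_PiM_reindex[of UNIV "\<lambda>_. H" "\<lambda>i. i" J] assms by (simp add: iid_def restrict_def)

lemma walk_Suc: "walk Y x (Suc t) = walk Y x t + Y (x (Suc t))"
  by (simp add: walk_def)

lemma walk_add: "walk Y x (c + t) = walk Y x c + walk Y (\<lambda>j. x (c + j)) t"
  by (induction t) (simp_all add: walk_def)

lemma walk_diff:
  assumes "t \<le> c"
  shows "walk Y x c - walk Y x (c - t) = walk Y (\<lambda>j. x (Suc c - j)) t"
  using assms
proof (induction t)
  case (Suc t)
  have "walk Y x (c - t) = walk Y x (c - Suc t) + Y (x (c - t))"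
    using Suc.prems Suc_diff_Suc[of t c] by (metis Suc_le_lessD walk_Suc)
  then show ?case
    using Suc by (simp add: walk_Suc)
qed (simp add: walk_def)

lemma walk_cong: "(\<And>j. j \<in> {1..t} \<Longrightarrow> x j = y j) \<Longrightarrow> walk Y x t = walk Y y t"
  unfolding walk_def by (intro sum.cong) auto

text \<open>
  The event \<open>E\<close> is given by the differences of the walk to its value at \<open>c\<close> at the times from \<open>lo\<close> to
  \<open>hi\<close>, and \<open>E'\<close> is the same event \<open>R\<close> for two independent walks. The truncations by \<open>min\<close> express that
  only these times matter while \<open>R\<close> is a predicate on two infinite sequences.
\<close>

lemma prob_eq_two_sided:
  fixes X :: "nat \<Rightarrow> 'w \<Rightarrow> 'a" and Y :: "'a \<Rightarrow> real"
  assumes P: "prob_space P" and indep: "prob_space.indep_vars P (\<lambda>_. M) X {lo<..hi}"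
    and le: "lo \<le> c" "c \<le> hi" "lo < hi"
    and H: "prob_space H1" "prob_space H2" "sets H1 = sets M" "sets H2 = sets M"
    and dist: "\<And>i. i \<in> {lo<..hi} \<Longrightarrow> distr P M (X i) = (if i \<le> c then H1 else H2)"
    and Y: "Y \<in> borel_measurable M"
    and R [measurable]: "Measurable.pred ((\<Pi>\<^sub>M i\<in>UNIV. borel) \<Otimes>\<^sub>M (\<Pi>\<^sub>M i\<in>UNIV. borel)) R"
    and E: "\<And>x. E x \<longleftrightarrow> R (\<lambda>j. walk Y x c - walk Y x (c - min j (c - lo)),
                           \<lambda>j. walk Y x (c + min j (hi - c)) - walk Y x c)"
    and E': "\<And>x y. E' x y \<longleftrightarrow> R (\<lambda>j. walk Y x (min j (c - lo)), \<lambda>j. walk Y y (min j (hi - c)))"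
  shows "measure P {\<omega> \<in> space P. E (\<lambda>i. X i \<omega>)}
       = measure (iid H1 \<Otimes>\<^sub>M iid H2) {z \<in> space (iid H1 \<Otimes>\<^sub>M iid H2). E' (fst z) (snd z)}"
proof -
  interpret P: prob_space P by fact
  define p q where "p = c - lo" and "q = hi - c"
  let ?N = "\<Pi>\<^sub>M i\<in>{lo<..hi}. if i \<le> c then H1 else H2"
  let ?M1 = "\<Pi>\<^sub>M i\<in>{1..p}. H1" and ?M2 = "\<Pi>\<^sub>M i\<in>{1..q}. H2"
  have YH: "Y \<in> borel_measurable H1" "Y \<in> borel_measurable H2"
    using Y measurable_cong_sets[OF H(3) refl] measurable_cong_sets[OF H(4) refl] by blast+
  have rv: "X i \<in> measurable P M" if "i \<in> {lo<..hi}" for i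
    using indep that by (simp add: P.indep_vars_def)
  have sets_N: "sets ?N = sets (\<Pi>\<^sub>M i\<in>{lo<..hi}. M)"
    using H by (intro sets_PiM_cong) auto
  have law: "distr P ?N (\<lambda>\<omega>. \<lambda>i\<in>{lo<..hi}. X i \<omega>) = ?N"
  proof -
    have "distr P (\<Pi>\<^sub>M i\<in>{lo<..hi}. M) (\<lambda>\<omega>. \<lambda>i\<in>{lo<..hi}. X i \<omega>) = (\<Pi>\<^sub>M i\<in>{lo<..hi}. distr P M (X i))"
      using indep rv le by (intro P.indep_vars_iff_distr_eq_PiM'[THEN iffD1]) auto
    also have "\<dots> = ?N"
      using dist by (intro PiM_cong) auto
    finally show ?thesis
      using distr_cong[OF refl sets_N refl, of P] by simp
  qed
  have X_meas: "(\<lambda>\<omega>. \<lambda>i\<in>{lo<..hi}. X i \<omega>) \<in> measurable P ?N"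
    unfolding measurable_cong_sets[OF refl sets_N] using rv by (rule measurable_restrict)
  define \<phi> where "\<phi> z = (\<lambda>j\<in>{1..p}. z (Suc c - j), \<lambda>j\<in>{1..q}. z (c + j))" for z :: "nat \<Rightarrow> 'a"
  have \<phi>_law: "distr ?N (?M1 \<Otimes>\<^sub>M ?M2) \<phi> = ?M1 \<Otimes>\<^sub>M ?M2"
    unfolding \<phi>_def[abs_def] p_def q_def using H le by (intro distr_PiM_two_sided)
  have \<phi>_meas: "\<phi> \<in> measurable ?N (?M1 \<Otimes>\<^sub>M ?M2)"
  proof -
    have "sets (?M1 \<Otimes>\<^sub>M ?M2) = sets ((\<Pi>\<^sub>M i\<in>{1..p}. M) \<Otimes>\<^sub>M (\<Pi>\<^sub>M i\<in>{1..q}. M))"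
      using H by (intro sets_pair_measure_cong sets_PiM_cong) auto
    moreover have "\<phi> \<in> measurable (\<Pi>\<^sub>M i\<in>{lo<..hi}. M) ((\<Pi>\<^sub>M i\<in>{1..p}. M) \<Otimes>\<^sub>M (\<Pi>\<^sub>M i\<in>{1..q}. M))"
      unfolding \<phi>_def
      using le by (intro measurable_Pair measurable_restrict measurable_component_singleton)
        (auto simp: p_def q_def)
    ultimately show ?thesis
      using measurable_cong_sets[OF sets_N] by blast
  qed
  have restr_meas: "(\<lambda>\<omega>. restrict \<omega> J) \<in> measurable (iid H) (\<Pi>\<^sub>M i\<in>J. H)" for J and H :: "'a measure"
    unfolding iid_def by (rule measurable_restrict_subset) simp
  define \<rho> where "\<rho> = (\<lambda>(x :: nat \<Rightarrow> 'a, y :: nat \<Rightarrow> 'a). (restrict x {1..p}, restrict y {1..q}))"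
  have \<rho>_meas: "\<rho> \<in> measurable (iid H1 \<Otimes>\<^sub>M iid H2) (?M1 \<Otimes>\<^sub>M ?M2)"
    unfolding \<rho>_def case_prod_beta'
    by (intro measurable_Pair measurable_compose[OF measurable_fst] measurable_compose[OF measurable_snd] restr_meas)
  have \<rho>_law: "distr (iid H1 \<Otimes>\<^sub>M iid H2) (?M1 \<Otimes>\<^sub>M ?M2) \<rho> = ?M1 \<Otimes>\<^sub>M ?M2"
  proof -
    have "distr (iid H1) ?M1 (\<lambda>\<omega>. restrict \<omega> {1..p}) \<Otimes>\<^sub>M distr (iid H2) ?M2 (\<lambda>\<omega>. restrict \<omega> {1..q})
        = distr (iid H1 \<Otimes>\<^sub>M iid H2) (?M1 \<Otimes>\<^sub>M ?M2) \<rho>"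
      unfolding \<rho>_def using H
      by (intro pair_measure_distr restr_meas)
         (auto simp: distr_iid_restrict intro!: prob_space_imp_sigma_finite prob_space_PiM)
    then show ?thesis
      using H by (simp add: distr_iid_restrict)
  qed
  define W where "W = (\<lambda>(x, y). (\<lambda>j. walk Y x (min j p), \<lambda>j. walk Y y (min j q)))"
  have W_meas: "W \<in> measurable (?M1 \<Otimes>\<^sub>M ?M2) ((\<Pi>\<^sub>M i\<in>UNIV. borel) \<Otimes>\<^sub>M (\<Pi>\<^sub>M i\<in>UNIV. borel))"
    unfolding W_def case_prod_beta' using YH
    by (intro measurable_Pair measurable_PiM_single' measurable_compose[OF measurable_fst]
          measurable_compose[OF measurable_snd] measurable_walk) (auto simp: space_PiM)
  define A where "A = {z \<in> space (?M1 \<Otimes>\<^sub>M ?M2). R (W z)}"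
  have A: "A \<in> sets (?M1 \<Otimes>\<^sub>M ?M2)"
    unfolding A_def using measurable_compose[OF W_meas R] by (simp add: pred_def)
  have W_\<phi>: "R (W (\<phi> (\<lambda>i\<in>{lo<..hi}. x i))) \<longleftrightarrow> E x" for x
  proof -
    have "walk Y (\<lambda>j\<in>{1..p}. (\<lambda>i\<in>{lo<..hi}. x i) (Suc c - j)) (min j p)
        = walk Y x c - walk Y x (c - min j p)" for j
      using le by (subst walk_diff) (auto simp: p_def intro!: walk_cong)
    moreover have "walk Y (\<lambda>j\<in>{1..q}. (\<lambda>i\<in>{lo<..hi}. x i) (c + j)) (min j q)
        = walk Y x (c + min j q) - walk Y x c" for j
      using le by (subst walk_add) (auto simp: q_def intro!: walk_cong)
    ultimately show ?thesis
      unfolding E W_def \<phi>_def by (simp add: p_def q_def)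
  qed
  have W_\<rho>: "R (W (\<rho> z)) \<longleftrightarrow> E' (fst z) (snd z)" for z
  proof -
    have "walk Y (restrict x {1..m}) (min j m) = walk Y x (min j m)" for x :: "nat \<Rightarrow> 'a" and j m
      by (rule walk_cong) auto
    then show ?thesis
      unfolding E' W_def \<rho>_def case_prod_beta' by (simp add: p_def q_def)
  qed
  have "measure (?M1 \<Otimes>\<^sub>M ?M2) A = measure (distr P (?M1 \<Otimes>\<^sub>M ?M2) (\<lambda>\<omega>. \<phi> (\<lambda>i\<in>{lo<..hi}. X i \<omega>))) A"
    using distr_distr[OF \<phi>_meas X_meas] by (simp only: law \<phi>_law comp_def)
  also have "\<dots> = measure P {\<omega> \<in> space P. E (\<lambda>i. X i \<omega>)}"
    using measurable_space[OF measurable_compose[OF X_meas \<phi>_meas]]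
    by (subst measure_distr[OF measurable_compose[OF X_meas \<phi>_meas] A])
       (auto simp: A_def W_\<phi> intro!: arg_cong[of _ _ "measure P"])
  finally have "measure P {\<omega> \<in> space P. E (\<lambda>i. X i \<omega>)} = measure (?M1 \<Otimes>\<^sub>M ?M2) A" ..
  also have "\<dots> = measure (distr (iid H1 \<Otimes>\<^sub>M iid H2) (?M1 \<Otimes>\<^sub>M ?M2) \<rho>) A"
    by (simp only: \<rho>_law)
  also have "\<dots> = measure (iid H1 \<Otimes>\<^sub>M iid H2) {z \<in> space (iid H1 \<Otimes>\<^sub>M iid H2). E' (fst z) (snd z)}"
    using measurable_space[OF \<rho>_meas]
    by (subst measure_distr[OF \<rho>_meas A])
       (auto simp: A_def W_\<rho> intro!: arg_cong[of _ _ "measure (iid H1 \<Otimes>\<^sub>M iid H2)"])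
  finally show ?thesis .
qed

section \<open>Sparre Andersen's bound\<close>

lemma indep_vars_iid_coordinates:
  assumes H: "prob_space H" and J: "J \<noteq> {}"
  shows "prob_space.indep_vars (iid H) (\<lambda>_. H) (\<lambda>i \<omega>. \<omega> i) J"
proof -
  interpret prob_space "iid H"
    using H by (rule prob_space_iid)
  have comp: "distr (iid H) H (\<lambda>\<omega>. \<omega> i) = H" for i
    using distr_PiM_component[of UNIV "\<lambda>_. H" i] H by (simp add: iid_def)
  have "(\<lambda>\<omega>. \<omega> i) \<in> measurable (iid H) H" for i
    unfolding iid_def by (rule measurable_component_singleton) simp
  then show ?thesis
    using distr_iid_restrict[OF H, of J] J
    by (subst indep_vars_iff_distr_eq_PiM) (simp_all add: comp restrict_def)
qed

text \<open>The probability that the walk with steps \<open>Y\<close> under \<open>H\<close> is in \<open>A\<close> at each of the times \<open>1, \<dots>, n\<close>.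
  The starting value \<open>0\<close> at time \<open>0\<close> need not be in \<open>A\<close>.\<close>

definition stay :: "real set \<Rightarrow> ('a \<Rightarrow> real) \<Rightarrow> 'a measure \<Rightarrow> nat \<Rightarrow> real" where
  "stay A Y H n = measure (iid H) {\<omega> \<in> space (iid H). \<forall>j\<in>{1..n}. walk Y \<omega> j \<in> A}"

lemma measure_pair_Times:
  assumes "prob_space M" "prob_space N" "A \<in> sets M" "B \<in> sets N"
  shows "measure (M \<Otimes>\<^sub>M N) (A \<times> B) = measure M A * measure N B"
proof -
  interpret N: prob_space N by fact
  show ?thesis
    using assms by (simp add: measure_def N.emeasure_pair_measure_Times enn2real_mult)
qed

lemma argmax_upto_eq_iff_two_sided:
  assumes "k \<le> n"
  shows "argmax_upto n h = k \<longleftrightarrow>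
    (\<forall>j\<in>{1..k}. 0 < h k - h (k - j)) \<and> (\<forall>j\<in>{1..n - k}. h (k + j) - h k \<le> 0)"
proof -
  have "(\<forall>i<k. h i < h k) \<longleftrightarrow> (\<forall>j\<in>{1..k}. h (k - j) < h k)"
  proof safe
    fix i assume "\<forall>j\<in>{1..k}. h (k - j) < h k" "i < k"
    then show "h i < h k" by (auto dest!: bspec[of _ _ "k - i"])
  qed auto
  moreover have "(\<forall>i. k < i \<and> i \<le> n \<longrightarrow> h i \<le> h k) \<longleftrightarrow> (\<forall>j\<in>{1..n - k}. h (k + j) \<le> h k)"
  proof safe
    fix i assume "\<forall>j\<in>{1..n - k}. h (k + j) \<le> h k" "k < i" "i \<le> n"
    then show "h i \<le> h k" by (auto dest!: bspec[of _ _ "i - k"])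
  qed auto
  ultimately show ?thesis
    using assms by (simp add: argmax_upto_eq_iff)
qed

lemma prob_two_sided_stay:
  fixes X :: "nat \<Rightarrow> 'w \<Rightarrow> 'a" and Y :: "'a \<Rightarrow> real"
  assumes P: "prob_space P" and indep: "prob_space.indep_vars P (\<lambda>_. M) X {lo<..hi}"
    and le: "lo \<le> c" "c \<le> hi" "lo < hi"
    and H: "prob_space H1" "prob_space H2" "sets H1 = sets M" "sets H2 = sets M"
    and dist: "\<And>i. i \<in> {lo<..hi} \<Longrightarrow> distr P M (X i) = (if i \<le> c then H1 else H2)"
    and Y: "Y \<in> borel_measurable M" and A [measurable]: "A \<in> sets borel" and B [measurable]: "B \<in> sets borel"
  shows "measure P {\<omega> \<in> space P.
        (\<forall>j\<in>{1..c - lo}. walk Y (\<lambda>i. X i \<omega>) c - walk Y (\<lambda>i. X i \<omega>) (c - j) \<in> A)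
        \<and> (\<forall>j\<in>{1..hi - c}. walk Y (\<lambda>i. X i \<omega>) (c + j) - walk Y (\<lambda>i. X i \<omega>) c \<in> B)}
      = stay A Y H1 (c - lo) * stay B Y H2 (hi - c)"
    (is "measure P ?E = _")
proof -
  have YH [measurable]: "Y \<in> borel_measurable H1" "Y \<in> borel_measurable H2"
    using Y measurable_cong_sets[OF H(3) refl] measurable_cong_sets[OF H(4) refl] by blast+
  let ?R = "\<lambda>(T, S). (\<forall>j\<in>{1..c - lo}. T j \<in> A) \<and> (\<forall>j\<in>{1..hi - c}. S j \<in> B)"
  have "measure P ?E = measure (iid H1 \<Otimes>\<^sub>M iid H2) {z \<in> space (iid H1 \<Otimes>\<^sub>M iid H2).
          (\<forall>j\<in>{1..c - lo}. walk Y (fst z) j \<in> A) \<and> (\<forall>j\<in>{1..hi - c}. walk Y (snd z) j \<in> B)}"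
  proof (rule prob_eq_two_sided[OF P indep le H dist Y, where R = ?R])
    show "Measurable.pred ((\<Pi>\<^sub>M i\<in>UNIV. borel) \<Otimes>\<^sub>M (\<Pi>\<^sub>M i\<in>UNIV. borel)) ?R"
      by measurable
  qed auto
  also have "{z \<in> space (iid H1 \<Otimes>\<^sub>M iid H2).
          (\<forall>j\<in>{1..c - lo}. walk Y (fst z) j \<in> A) \<and> (\<forall>j\<in>{1..hi - c}. walk Y (snd z) j \<in> B)}
     = {\<omega> \<in> space (iid H1). \<forall>j\<in>{1..c - lo}. walk Y \<omega> j \<in> A}
       \<times> {\<omega> \<in> space (iid H2). \<forall>j\<in>{1..hi - c}. walk Y \<omega> j \<in> B}"
    by (auto simp: space_pair_measure)
  also have "measure (iid H1 \<Otimes>\<^sub>M iid H2) \<dots> = stay A Y H1 (c - lo) * stay B Y H2 (hi - c)"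
    unfolding stay_def using H by (intro measure_pair_Times prob_space_iid) measurable
  finally show ?thesis .
qed

lemma prob_argmax_upto_eq:
  assumes H: "prob_space H" and Y: "Y \<in> borel_measurable H" and k: "k \<le> n"
  shows "measure (iid H) {\<omega> \<in> space (iid H). argmax_upto n (walk Y \<omega>) = k}
       = stay {0<..} Y H k * stay {..0} Y H (n - k)"
proof (cases "n = 0")
  case True
  interpret prob_space "iid H"
    using H by (rule prob_space_iid)
  show ?thesis
    using True k by (simp add: stay_def argmax_upto_eq_iff prob_space)
next
  case False
  have comp: "distr (iid H) H (\<lambda>\<omega>. \<omega> i) = H" for i
    using distr_PiM_component[of UNIV "\<lambda>_. H" i] H by (simp add: iid_def)
  have "measure (iid H) {\<omega> \<in> space (iid H). argmax_upto n (walk Y \<omega>) = k}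
      = measure (iid H) {\<omega> \<in> space (iid H).
          (\<forall>j\<in>{1..k - 0}. walk Y (\<lambda>i. \<omega> i) k - walk Y (\<lambda>i. \<omega> i) (k - j) \<in> {0<..})
        \<and> (\<forall>j\<in>{1..n - k}. walk Y (\<lambda>i. \<omega> i) (k + j) - walk Y (\<lambda>i. \<omega> i) k \<in> {..0})}"
    unfolding argmax_upto_eq_iff_two_sided[OF k] by simp
  also have "\<dots> = stay {0<..} Y H (k - 0) * stay {..0} Y H (n - k)"
    using False by (intro prob_two_sided_stay[where M = H] indep_vars_iid_coordinates prob_space_iid)
      (auto simp: H Y k comp)
  finally show ?thesis by simp
qed

lemma integral_argmax_upto:
  fixes f :: "nat \<Rightarrow> real"
  assumes H: "prob_space H" and Y [measurable]: "Y \<in> borel_measurable H"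
  shows "(\<integral>\<omega>. f (argmax_upto n (walk Y \<omega>)) \<partial>iid H)
       = (\<Sum>k\<le>n. f k * stay {0<..} Y H k * stay {..0} Y H (n - k))"
proof -
  interpret prob_space "iid H"
    using H by (rule prob_space_iid)
  have [measurable]: "(\<lambda>\<omega>. argmax_upto n (walk Y \<omega>)) \<in> measurable (iid H) (count_space UNIV)"
    by (rule measurable_argmax_upto) measurable
  define A where "A k = {\<omega> \<in> space (iid H). argmax_upto n (walk Y \<omega>) = k}" for k
  have [measurable]: "A k \<in> sets (iid H)" for k
    unfolding A_def by measurable
  have int: "integrable (iid H) (indicator (A k) :: _ \<Rightarrow> real)" for k
    by (rule integrable_real_indicator) (auto simp: less_top[symmetric])
  have A_space: "A k \<inter> space (iid H) = A k" for k
    by (auto simp: A_def)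
  have "(\<integral>\<omega>. f (argmax_upto n (walk Y \<omega>)) \<partial>iid H) = (\<integral>\<omega>. (\<Sum>k\<le>n. f k * indicator (A k) \<omega>) \<partial>iid H)"
  proof (rule Bochner_Integration.integral_cong[OF refl])
    fix \<omega> assume \<omega>: "\<omega> \<in> space (iid H)"
    have "(\<Sum>k\<le>n. f k * indicator (A k) \<omega>) = (\<Sum>k\<le>n. if k = argmax_upto n (walk Y \<omega>) then f k else 0)"
      using \<omega> by (intro sum.cong) (auto simp: A_def indicator_def)
    then show "f (argmax_upto n (walk Y \<omega>)) = (\<Sum>k\<le>n. f k * indicator (A k) \<omega>)"
      by (simp add: argmax_upto_le)
  qed
  also have "\<dots> = (\<Sum>k\<le>n. f k * measure (iid H) (A k))"
    by (subst Bochner_Integration.integral_sum) (auto simp: int A_space)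
  also have "\<dots> = (\<Sum>k\<le>n. f k * stay {0<..} Y H k * stay {..0} Y H (n - k))"
    using prob_argmax_upto_eq[OF H Y] by (intro sum.cong) (auto simp: A_def mult.assoc)
  finally show ?thesis .
qed

lemma sum_stay:
  assumes H: "prob_space H" and Y: "Y \<in> borel_measurable H"
  shows "(\<Sum>k\<le>n. stay {0<..} Y H k * stay {..0} Y H (n - k)) = 1"
proof -
  interpret prob_space "iid H"
    using H by (rule prob_space_iid)
  show ?thesis
    using integral_argmax_upto[OF H Y, of "\<lambda>_. 1" n] by (simp add: prob_space)
qed

lemma sum_of_nat_stay:
  assumes H: "prob_space H" and Y: "Y \<in> borel_measurable H"
  shows "(\<Sum>k\<le>n. real k * stay {0<..} Y H k * stay {..0} Y H (n - k))
       = (\<Sum>k<n. measure (iid H) {\<omega> \<in> space (iid H). 0 < walk Y \<omega> (Suc k)})"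
proof -
  have "(\<integral>\<omega>. real (argmax_upto n (walk Y \<omega>)) \<partial>iid H)
      = (\<Sum>k<n. measure (iid H) {\<omega> \<in> space (iid H). 0 < walk Y \<omega> (Suc k)})"
  proof (induction n)
    case 0
    have "argmax_upto 0 h = 0" for h :: "nat \<Rightarrow> real"
      using argmax_upto_le[of 0 h] by simp
    then show ?case by simp
  qed (simp add: integral_argmax_upto_Suc[OF H Y])
  then show ?thesis
    using integral_argmax_upto[OF H Y, of real n] by simp
qed

lemma stay_0: "prob_space H \<Longrightarrow> stay A Y H 0 = 1"
  using prob_space.prob_space[OF prob_space_iid] by (simp add: stay_def)

lemma decseq_stay:
  assumes H: "prob_space H" and [measurable]: "Y \<in> borel_measurable H" "A \<in> sets borel"
  shows "decseq (stay A Y H)"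
proof -
  interpret prob_space "iid H"
    using H by (rule prob_space_iid)
  show ?thesis
    unfolding stay_def by (rule decseq_SucI, rule finite_measure_mono) auto
qed

lemma stay_nonneg: "0 \<le> stay A Y H n"
  by (simp add: stay_def)

text \<open>The limit of the right-hand side as \<open>N\<close> tends to infinity equals the left-hand side, but only this
  inequality is needed.\<close>

lemma exp_le_stay_nonpos:
  assumes H: "prob_space H" and Y: "Y \<in> borel_measurable H"
    and summable: "summable (\<lambda>k. measure (iid H) {\<omega> \<in> space (iid H). 0 < walk Y \<omega> (Suc k)} / real (Suc k))"
  shows "exp (- (\<Sum>k. measure (iid H) {\<omega> \<in> space (iid H). 0 < walk Y \<omega> (Suc k)} / real (Suc k))) \<le> stay {..0} Y H N"
proof -
  interpret prob_space "iid H"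
    using H by (rule prob_space_iid)
  show ?thesis
    by (rule exp_le_of_convolution[where u = "stay {0<..} Y H"
          and q = "\<lambda>k. measure (iid H) {\<omega> \<in> space (iid H). 0 < walk Y \<omega> k}"])
       (use stay_0[OF H] decseq_stay[OF H Y, of "{..0}"] sum_stay[OF H Y] sum_of_nat_stay[OF H Y] summable
          in \<open>auto simp: stay_nonneg\<close>)
qed

text \<open>The mirror image of \<open>exp_le_stay_nonpos\<close>, with \<open>n - L\<^sub>n\<close> in place of \<open>L\<^sub>n\<close>.\<close>

lemma exp_le_stay_pos:
  assumes H: "prob_space H" and Y [measurable]: "Y \<in> borel_measurable H"
    and summable: "summable (\<lambda>k. measure (iid H) {\<omega> \<in> space (iid H). walk Y \<omega> (Suc k) \<le> 0} / real (Suc k))"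
  shows "exp (- (\<Sum>k. measure (iid H) {\<omega> \<in> space (iid H). walk Y \<omega> (Suc k) \<le> 0} / real (Suc k))) \<le> stay {0<..} Y H N"
proof -
  interpret prob_space "iid H"
    using H by (rule prob_space_iid)
  let ?u = "stay {0<..} Y H" and ?v = "stay {..0} Y H"
  have conv: "(\<Sum>k\<le>n. ?v k * ?u (n - k)) = 1" for n
    using sum_stay[OF H Y, of n] sum.nat_diff_reindex[of "\<lambda>k. ?u k * ?v (n - k)" "Suc n"]
    by (simp add: lessThan_Suc_atMost mult.commute)
  have compl: "measure (iid H) {\<omega> \<in> space (iid H). walk Y \<omega> k \<le> 0}
      = 1 - measure (iid H) {\<omega> \<in> space (iid H). 0 < walk Y \<omega> k}" for k
    by (subst prob_neg[symmetric]) (auto simp: not_less)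
  have mean: "(\<Sum>k\<le>n. real k * ?v k * ?u (n - k))
      = (\<Sum>k<n. measure (iid H) {\<omega> \<in> space (iid H). walk Y \<omega> (Suc k) \<le> 0})" for n
  proof -
    have "(\<Sum>k\<le>n. real k * ?v k * ?u (n - k)) = (\<Sum>k\<le>n. (real n - real k) * ?u k * ?v (n - k))"
      using sum.nat_diff_reindex[of "\<lambda>k. (real n - real k) * ?u k * ?v (n - k)" "Suc n"]
      by (simp add: lessThan_Suc_atMost mult_ac of_nat_diff)
    also have "\<dots> = real n * (\<Sum>k\<le>n. ?u k * ?v (n - k)) - (\<Sum>k\<le>n. real k * ?u k * ?v (n - k))"
      by (simp add: sum_distrib_left sum_subtractf[symmetric] algebra_simps)
    also have "\<dots> = (\<Sum>k<n. 1 - measure (iid H) {\<omega> \<in> space (iid H). 0 < walk Y \<omega> (Suc k)})"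
      by (simp add: sum_stay[OF H Y] sum_of_nat_stay[OF H Y] sum_subtractf)
    finally show ?thesis
      by (simp add: compl)
  qed
  show ?thesis
    by (rule exp_le_of_convolution[where u = ?v
          and q = "\<lambda>k. measure (iid H) {\<omega> \<in> space (iid H). walk Y \<omega> k \<le> 0}"])
       (use stay_0[OF H] decseq_stay[OF H Y, of "{0<..}"] conv mean summable in \<open>auto simp: stay_nonneg\<close>)
qed

text \<open>The exponent of \<open>zero_bound\<close> uses \<open>P\<^sub>F(S\<^sub>m \<ge> 0)\<close>, which is at least \<open>P\<^sub>F(S\<^sub>m > 0)\<close>. If the series
  diverges, the bound is \<open>0\<close>.\<close>

lemma zero_bound_le:
  assumes F: "prob_space F" and G: "prob_space G"
    and Y: "Y \<in> borel_measurable F" "Y \<in> borel_measurable G"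
  shows "zero_bound Y F G \<le> stay {..0} Y F m * stay {0<..} Y G k"
proof -
  interpret F: prob_space "iid F"
    using F by (rule prob_space_iid)
  interpret G: prob_space "iid G"
    using G by (rule prob_space_iid)
  define \<alpha> where "\<alpha> i = measure (iid F) {\<omega> \<in> space (iid F). 0 \<le> walk Y \<omega> (Suc i)} / real (Suc i)" for i
  define \<beta> where "\<beta> i = measure (iid G) {\<omega> \<in> space (iid G). walk Y \<omega> (Suc i) \<le> 0} / real (Suc i)" for i
  have zb: "zero_bound Y F G = exp_minus (\<Sum>i. ennreal (\<alpha> i + \<beta> i))"
    by (simp add: zero_bound_def \<alpha>_def \<beta>_def walk_def Let_def add_divide_distrib)
  have nonneg: "0 \<le> \<alpha> i" "0 \<le> \<beta> i" for i
    by (simp_all add: \<alpha>_def \<beta>_def)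
  show ?thesis
  proof (cases "(\<Sum>i. ennreal (\<alpha> i + \<beta> i)) = \<infinity>")
    case True
    then show ?thesis
      by (simp add: zb exp_minus_def stay_def)
  next
    case False
    then have sum: "summable (\<lambda>i. \<alpha> i + \<beta> i)"
      using nonneg by (intro summable_suminf_not_top) auto
    have sum_\<beta>: "summable \<beta>"
      using nonneg by (intro summable_comparison_test'[OF sum]) auto
    have sum_\<alpha>: "summable \<alpha>"
      using nonneg by (intro summable_comparison_test'[OF sum]) auto
    define \<alpha>' where "\<alpha>' i = measure (iid F) {\<omega> \<in> space (iid F). 0 < walk Y \<omega> (Suc i)} / real (Suc i)" for i
    have \<alpha>': "\<alpha>' i \<le> \<alpha> i" "0 \<le> \<alpha>' i" for i
      using measurable_walk_iid[OF Y(1)]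
      by (auto simp: \<alpha>_def \<alpha>'_def intro!: divide_right_mono F.finite_measure_mono)
    have sum_\<alpha>': "summable \<alpha>'"
      using \<alpha>' by (intro summable_comparison_test'[OF sum_\<alpha>]) auto
    have "(\<Sum>i. ennreal (\<alpha> i + \<beta> i)) = ennreal ((\<Sum>i. \<alpha> i) + (\<Sum>i. \<beta> i))"
      using nonneg sum by (simp add: suminf_ennreal2 suminf_add[OF sum_\<alpha> sum_\<beta>] del: ennreal_plus)
    moreover have "0 \<le> (\<Sum>i. \<alpha> i) + (\<Sum>i. \<beta> i)"
      using nonneg sum_\<alpha> sum_\<beta> by (intro add_nonneg_nonneg suminf_nonneg)
    ultimately have "zero_bound Y F G = exp (- (\<Sum>i. \<alpha> i)) * exp (- (\<Sum>i. \<beta> i))"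
      by (simp add: zb exp_minus_def exp_add[symmetric] del: ennreal_plus)
    also have "\<dots> \<le> exp (- (\<Sum>i. \<alpha>' i)) * exp (- (\<Sum>i. \<beta> i))"
      using suminf_le[OF \<alpha>'(1) sum_\<alpha>' sum_\<alpha>] by simp
    also have "\<dots> \<le> stay {..0} Y F m * stay {0<..} Y G k"
      unfolding \<alpha>'_def \<beta>_def
      by (intro mult_mono exp_le_stay_nonpos[OF F Y(1) sum_\<alpha>'[unfolded \<alpha>'_def]]
          exp_le_stay_pos[OF G Y(2) sum_\<beta>[unfolded \<beta>_def]] stay_nonneg) simp_all
    finally show ?thesis .
  qed
qed

section \<open>The integrals as probabilities of events for two independent walks\<close>

text \<open>Replacing \<open>Y\<close> by \<open>- Y\<close> turns the minus versions of \<open>R\<close> and \<open>B\<close> into the plus versions.\<close>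

lemma walk_uminus: "walk (\<lambda>x. - Y x) \<omega> t = - walk Y \<omega> t"
  by (simp add: walk_def sum_negf)

lemma R_minus_inf_eq: "R_minus_inf Y = R_plus_inf (\<lambda>x. - Y x)"
  by (simp add: fun_eq_iff R_minus_inf_def R_plus_inf_def R_minus_def R_plus_def walk_uminus)

lemma B_minus_inf_eq: "B_minus_inf Y = B_plus_inf (\<lambda>x. - Y x)"
  by (simp add: fun_eq_iff B_minus_inf_def B_plus_inf_def B_minus_def B_plus_def walk_uminus)

lemma R_plus_eq:
  "R_plus Y H m x = measure (iid H) {\<omega> \<in> space (iid H). \<forall>j\<le>m. walk Y \<omega> j < x}"
proof -
  have "Max (insert 0 ((\<lambda>i. walk Y \<omega> i) ` {1..m})) < x \<longleftrightarrow> (\<forall>j\<le>m. walk Y \<omega> j < x)" for \<omega>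
  proof -
    have "insert 0 ((\<lambda>i. walk Y \<omega> i) ` {1..m}) = (\<lambda>i. walk Y \<omega> i) ` {..m}"
    proof -
      have "{..m} = insert 0 {1..m}" by auto
      moreover have "walk Y \<omega> 0 = 0" by (simp add: walk_def)
      ultimately show ?thesis by simp
    qed
    then show ?thesis by auto
  qed
  then show ?thesis
    by (simp add: R_plus_def)
qed

lemma R_plus_inf_le:
  assumes H: "prob_space H" and [measurable]: "Y \<in> borel_measurable H"
  shows "R_plus_inf Y H x \<le> R_plus Y H m x"
proof -
  interpret prob_space "iid H"
    using H by (rule prob_space_iid)
  have "decseq (\<lambda>k. R_plus Y H k x)"
    unfolding R_plus_eq by (rule decseq_SucI, rule finite_measure_mono) auto
  moreover have "\<bar>R_plus Y H k x\<bar> \<le> 1" for k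
    by (simp add: R_plus_def)
  ultimately have "convergent (\<lambda>k. R_plus Y H k x)"
    by (intro Bseq_monoseq_convergent BseqI'[of _ 1]) (auto simp: monoseq_iff)
  then show ?thesis
    using decseq_ge[OF \<open>decseq _\<close>] unfolding R_plus_inf_def convergent_LIMSEQ_iff by blast
qed

lemma borel_measurable_R_plus:
  assumes H: "prob_space H" and [measurable]: "Y \<in> borel_measurable H"
  shows "R_plus Y H m \<in> borel_measurable borel"
proof -
  interpret prob_space "iid H"
    using H by (rule prob_space_iid)
  have "mono (R_plus Y H m)"
    unfolding R_plus_eq by (rule monoI, rule finite_measure_mono) (auto intro: less_le_trans)
  then show ?thesis
    by (rule borel_measurable_mono)
qed

lemma B_plus_eq_distr:
  assumes [measurable]: "Y \<in> borel_measurable H"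
  shows "B_plus Y H k s = distr (density (iid H)
      (indicator {\<omega> \<in> space (iid H). argmax_upto (k + s) (walk Y \<omega>) = k})) borel (\<lambda>\<omega>. walk Y \<omega> k)"
    (is "_ = ?N")
proof -
  have [measurable]: "(\<lambda>\<omega>. argmax_upto (k + s) (walk Y \<omega>)) \<in> measurable (iid H) (count_space UNIV)"
    by (rule measurable_argmax_upto) measurable
  have "emeasure ?N B = emeasure (iid H) {\<omega> \<in> space (iid H).
      argmax_upto (k + s) (\<lambda>i. walk Y \<omega> i) = k \<and> walk Y \<omega> k \<in> B}" if [measurable]: "B \<in> sets borel" for B
    by (simp add: emeasure_distr emeasure_restricted measurable_sets)
       (auto intro!: arg_cong[of _ _ "emeasure (iid H)"])
  then have "B_plus Y H k s = measure_of UNIV (sets borel) (emeasure ?N)"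
    unfolding B_plus_def by (intro measure_of_eq) (auto simp: sets.sigma_sets_eq[of borel, simplified])
  also have "\<dots> = ?N"
    using measure_of_of_measure[of ?N] by simp
  finally show ?thesis .
qed

lemma sets_B_plus_inf [simp]: "sets (B_plus_inf Y H k) = sets borel"
  unfolding B_plus_inf_def using sets.sigma_sets_eq[of borel] by (simp add: sets.space_closed)

text \<open>The set function defining \<open>B_plus_inf\<close> is the decreasing limit of the measures \<open>B_plus\<close>. Its
  countable additivity is not needed: if it failed, \<open>measure_of\<close> would yield the zero measure.\<close>

lemma B_plus_inf_le:
  assumes Y [measurable]: "Y \<in> borel_measurable H"
  shows "B_plus_inf Y H k \<le> B_plus Y H k s"
proof -
  have sets_B: "sets (B_plus Y H k s) = sets borel" for s
    by (simp add: B_plus_eq_distr[OF Y])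
  have [measurable]: "(\<lambda>\<omega>. argmax_upto n (walk Y \<omega>)) \<in> measurable (iid H) (count_space UNIV)" for n
    by (rule measurable_argmax_upto) measurable
  have "emeasure (B_plus_inf Y H k) B \<le> emeasure (B_plus Y H k s) B" if B: "B \<in> sets borel" for B
  proof -
    have dec: "decseq (\<lambda>s. emeasure (B_plus Y H k s) B)"
    proof (rule decseq_SucI)
      fix s
      have "argmax_upto (k + s) h = k" if "argmax_upto (k + Suc s) h = k" for h
        using that unfolding argmax_upto_eq_iff by simp
      then have "{\<omega> \<in> space (iid H). argmax_upto (k + Suc s) (walk Y \<omega>) = k} \<inter> ((\<lambda>\<omega>. walk Y \<omega> k) -` B \<inter> space (iid H))
          \<subseteq> {\<omega> \<in> space (iid H). argmax_upto (k + s) (walk Y \<omega>) = k} \<inter> ((\<lambda>\<omega>. walk Y \<omega> k) -` B \<inter> space (iid H))"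
        by blast
      then show "emeasure (B_plus Y H k (Suc s)) B \<le> emeasure (B_plus Y H k s) B"
        unfolding B_plus_eq_distr[OF Y] using B
        by (simp add: emeasure_distr emeasure_restricted measurable_sets emeasure_mono del: add_Suc_right)
    qed
    have "emeasure (B_plus_inf Y H k) B \<le> lim (\<lambda>s. emeasure (B_plus Y H k s) B)"
      unfolding B_plus_inf_def emeasure_measure_of_conv by simp
    also have "\<dots> = (INF s. emeasure (B_plus Y H k s) B)"
      using LIMSEQ_INF[OF dec] by (rule limI)
    also have "\<dots> \<le> emeasure (B_plus Y H k s) B"
      by (rule INF_lower) simp
    finally show ?thesis .
  qed
  then show ?thesis
    by (subst le_measure) (auto simp: sets_B)
qed

lemma integral_B_plus_inf_le:
  assumes H: "prob_space H1" "prob_space H2"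
    and Y1 [measurable]: "Y1 \<in> borel_measurable H1" and Y2 [measurable]: "Y2 \<in> borel_measurable H2"
    and k: "k \<le> n"
  shows "(LINT x:{0..}|B_plus_inf Y1 H1 k. R_plus_inf Y2 H2 x)
    \<le> measure (iid H1 \<Otimes>\<^sub>M iid H2) {z \<in> space (iid H1 \<Otimes>\<^sub>M iid H2).
        argmax_upto n (walk Y1 (fst z)) = k \<and> (\<forall>j\<le>m. walk Y2 (snd z) j < walk Y1 (fst z) k)}"
    (is "_ \<le> measure ?M ?S")
proof -
  interpret I1: prob_space "iid H1"
    using H(1) by (rule prob_space_iid)
  interpret I2: prob_space "iid H2"
    using H(2) by (rule prob_space_iid)
  interpret pair_prob_space "iid H1" "iid H2" ..
  obtain s where n: "n = k + s"
    using k le_Suc_ex by blast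
  have [measurable]: "(\<lambda>\<omega>. argmax_upto n (walk Y1 \<omega>)) \<in> measurable (iid H1) (count_space UNIV)"
    by (rule measurable_argmax_upto) measurable
  have R_meas [measurable]: "R_plus Y2 H2 m \<in> borel_measurable borel"
    using H(2) Y2 by (rule borel_measurable_R_plus)
  have S: "?S \<in> sets ?M"
    by measurable
  define A where "A = {\<omega> \<in> space (iid H1). argmax_upto n (walk Y1 \<omega>) = k}"
  have [measurable]: "A \<in> sets (iid H1)"
    unfolding A_def by measurable
  have "(\<integral>\<^sup>+x. ennreal (indicator {0..} x *\<^sub>R R_plus_inf Y2 H2 x) \<partial>B_plus_inf Y1 H1 k)
      \<le> (\<integral>\<^sup>+x. ennreal (R_plus Y2 H2 m x) \<partial>B_plus_inf Y1 H1 k)"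
    using R_plus_inf_le[OF H(2) Y2]
    by (intro nn_integral_mono) (auto split: split_indicator intro: ennreal_leI simp: R_plus_def)
  also have "\<dots> \<le> (\<integral>\<^sup>+x. ennreal (R_plus Y2 H2 m x) \<partial>B_plus Y1 H1 k s)"
    using B_plus_inf_le[OF Y1] by (intro nn_integral_mono_measure) (simp_all add: B_plus_eq_distr[OF Y1])
  also have "\<dots> = (\<integral>\<^sup>+\<omega>. indicator A \<omega> * ennreal (R_plus Y2 H2 m (walk Y1 \<omega> k)) \<partial>iid H1)"
    by (simp add: B_plus_eq_distr nn_integral_distr nn_integral_density n[symmetric] A_def[symmetric])
  also have "\<dots> = (\<integral>\<^sup>+\<omega>. emeasure (iid H2) (Pair \<omega> -` ?S) \<partial>iid H1)"
  proof (rule nn_integral_cong)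
    fix \<omega> assume "\<omega> \<in> space (iid H1)"
    then have "Pair \<omega> -` ?S = (if \<omega> \<in> A then {\<omega>' \<in> space (iid H2). \<forall>j\<le>m. walk Y2 \<omega>' j < walk Y1 \<omega> k} else {})"
      by (auto simp: A_def space_pair_measure)
    then show "indicator A \<omega> * ennreal (R_plus Y2 H2 m (walk Y1 \<omega> k)) = emeasure (iid H2) (Pair \<omega> -` ?S)"
      by (simp add: R_plus_eq I2.emeasure_eq_measure)
  qed
  also have "\<dots> = emeasure ?M ?S"
    using S by (rule I2.emeasure_pair_measure_alt[symmetric])
  also have "\<dots> = ennreal (measure ?M ?S)"
    by (rule emeasure_eq_measure)
  finally show ?thesis
    unfolding set_lebesgue_integral_def by (intro integral_real_bounded) auto
qed

section \<open>The integrals as bounds for events around a change-point\<close>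

lemma measure_pair_swap:
  assumes "prob_space M" "prob_space N" and S: "{z \<in> space (M \<Otimes>\<^sub>M N). Q (fst z) (snd z)} \<in> sets (M \<Otimes>\<^sub>M N)"
  shows "measure (N \<Otimes>\<^sub>M M) {z \<in> space (N \<Otimes>\<^sub>M M). Q (snd z) (fst z)}
       = measure (M \<Otimes>\<^sub>M N) {z \<in> space (M \<Otimes>\<^sub>M N). Q (fst z) (snd z)}"
proof -
  interpret M: prob_space M by fact
  interpret N: prob_space N by fact
  interpret pair_sigma_finite M N ..
  have "measure (M \<Otimes>\<^sub>M N) {z \<in> space (M \<Otimes>\<^sub>M N). Q (fst z) (snd z)}
      = measure (distr (N \<Otimes>\<^sub>M M) (M \<Otimes>\<^sub>M N) (\<lambda>(x, y). (y, x))) {z \<in> space (M \<Otimes>\<^sub>M N). Q (fst z) (snd z)}"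
    by (simp only: distr_pair_swap[symmetric])
  also have "\<dots> = measure (N \<Otimes>\<^sub>M M) {z \<in> space (N \<Otimes>\<^sub>M M). Q (snd z) (fst z)}"
    using S by (subst measure_distr) (auto simp: space_pair_measure intro!: arg_cong[of _ _ "measure (N \<Otimes>\<^sub>M M)"])
  finally show ?thesis ..
qed

text \<open>On the event, the maximum of the walk over \<open>{lo..hi}\<close> is attained at \<open>c - k\<close>; among the times up
  to \<open>c\<close>, this is the last such time.\<close>

lemma integral_le_prob_argmax_backward:
  fixes X :: "nat \<Rightarrow> 'w \<Rightarrow> 'a" and Y :: "'a \<Rightarrow> real"
  assumes P: "prob_space P" and indep: "prob_space.indep_vars P (\<lambda>_. M) X {lo<..hi}"
    and le: "lo \<le> c" "c \<le> hi" "lo < hi"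
    and H: "prob_space H1" "prob_space H2" "sets H1 = sets M" "sets H2 = sets M"
    and dist: "\<And>i. i \<in> {lo<..hi} \<Longrightarrow> distr P M (X i) = (if i \<le> c then H1 else H2)"
    and Y: "Y \<in> borel_measurable M" and k: "k \<le> c - lo"
  shows "(LINT x:{0..}|B_plus_inf (\<lambda>x. - Y x) H1 k. R_plus_inf Y H2 x)
    \<le> measure P {\<omega> \<in> space P. argmax_upto (c - lo) (\<lambda>j. walk Y (\<lambda>i. X i \<omega>) (c - j)) = k
        \<and> (\<forall>j\<le>hi - c. walk Y (\<lambda>i. X i \<omega>) (c + j) < walk Y (\<lambda>i. X i \<omega>) (c - k))}"
proof -
  have YH [measurable]: "Y \<in> borel_measurable H1" "Y \<in> borel_measurable H2"
    using Y measurable_cong_sets[OF H(3) refl] measurable_cong_sets[OF H(4) refl] by blast+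
  let ?R = "\<lambda>(T, S). argmax_upto (c - lo) (\<lambda>j. - T j) = k \<and> (\<forall>j\<le>hi - c. S j < (- T k :: real))"
  have [measurable]: "(\<lambda>z. argmax_upto (c - lo) (\<lambda>j. - (fst z j :: real)))
      \<in> measurable ((\<Pi>\<^sub>M i\<in>UNIV. borel) \<Otimes>\<^sub>M (\<Pi>\<^sub>M i\<in>UNIV. borel)) (count_space UNIV)"
    by (rule measurable_argmax_upto) measurable
  have "(LINT x:{0..}|B_plus_inf (\<lambda>x. - Y x) H1 k. R_plus_inf Y H2 x)
      \<le> measure (iid H1 \<Otimes>\<^sub>M iid H2) {z \<in> space (iid H1 \<Otimes>\<^sub>M iid H2).
        argmax_upto (c - lo) (walk (\<lambda>x. - Y x) (fst z)) = k
        \<and> (\<forall>j\<le>hi - c. walk Y (snd z) j < walk (\<lambda>x. - Y x) (fst z) k)}"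
    using H k by (intro integral_B_plus_inf_le) auto
  also have "\<dots> = measure P {\<omega> \<in> space P. argmax_upto (c - lo) (\<lambda>j. walk Y (\<lambda>i. X i \<omega>) (c - j)) = k
        \<and> (\<forall>j\<le>hi - c. walk Y (\<lambda>i. X i \<omega>) (c + j) < walk Y (\<lambda>i. X i \<omega>) (c - k))}"
  proof (rule prob_eq_two_sided[OF P indep le H dist Y, where R = ?R, symmetric])
    show "Measurable.pred ((\<Pi>\<^sub>M i\<in>UNIV. borel) \<Otimes>\<^sub>M (\<Pi>\<^sub>M i\<in>UNIV. borel)) ?R"
      unfolding case_prod_beta' by measurable
    show "argmax_upto (c - lo) (\<lambda>j. walk Y x (c - j)) = k \<and> (\<forall>j\<le>hi - c. walk Y x (c + j) < walk Y x (c - k)) \<longleftrightarrow>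
      ?R (\<lambda>j. walk Y x c - walk Y x (c - min j (c - lo)), \<lambda>j. walk Y x (c + min j (hi - c)) - walk Y x c)" for x
    proof -
      have "argmax_upto (c - lo) (\<lambda>j. - (walk Y x c - walk Y x (c - min j (c - lo))))
          = argmax_upto (c - lo) (\<lambda>j. walk Y x (c - j) - walk Y x c)"
        by (rule argmax_upto_cong) auto
      also have "\<dots> = argmax_upto (c - lo) (\<lambda>j. walk Y x (c - j))"
        by (rule argmax_upto_shift)
      finally show ?thesis
        using k by auto
    qed
    show "argmax_upto (c - lo) (walk (\<lambda>x. - Y x) x) = k
          \<and> (\<forall>j\<le>hi - c. walk Y y j < walk (\<lambda>x. - Y x) x k) \<longleftrightarrow>
        ?R (\<lambda>j. walk Y x (min j (c - lo)), \<lambda>j. walk Y y (min j (hi - c)))" for x y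
    proof -
      have "argmax_upto (c - lo) (\<lambda>j. - walk Y x (min j (c - lo))) = argmax_upto (c - lo) (walk (\<lambda>x. - Y x) x)"
        by (rule argmax_upto_cong) (auto simp: walk_uminus)
      then show ?thesis
        using k by (auto simp: walk_uminus)
    qed
  qed
  finally show ?thesis .
qed

text \<open>The mirror image of \<open>integral_le_prob_argmax_backward\<close>: the maximum over \<open>{lo..hi}\<close> is attained at
  \<open>c + k\<close>, and this is the first such time.\<close>

lemma integral_le_prob_argmax_forward:
  fixes X :: "nat \<Rightarrow> 'w \<Rightarrow> 'a" and Y :: "'a \<Rightarrow> real"
  assumes P: "prob_space P" and indep: "prob_space.indep_vars P (\<lambda>_. M) X {lo<..hi}"
    and le: "lo \<le> c" "c \<le> hi" "lo < hi"
    and H: "prob_space H1" "prob_space H2" "sets H1 = sets M" "sets H2 = sets M"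
    and dist: "\<And>i. i \<in> {lo<..hi} \<Longrightarrow> distr P M (X i) = (if i \<le> c then H1 else H2)"
    and Y: "Y \<in> borel_measurable M" and k: "k \<le> hi - c"
  shows "(LINT x:{0..}|B_plus_inf Y H2 k. R_plus_inf (\<lambda>x. - Y x) H1 x)
    \<le> measure P {\<omega> \<in> space P. argmax_upto (hi - c) (\<lambda>j. walk Y (\<lambda>i. X i \<omega>) (c + j)) = k
        \<and> (\<forall>j\<le>c - lo. walk Y (\<lambda>i. X i \<omega>) (c - j) < walk Y (\<lambda>i. X i \<omega>) (c + k))}"
proof -
  have YH [measurable]: "Y \<in> borel_measurable H1" "Y \<in> borel_measurable H2"
    using Y measurable_cong_sets[OF H(3) refl] measurable_cong_sets[OF H(4) refl] by blast+
  let ?R = "\<lambda>(T, S). argmax_upto (hi - c) S = k \<and> (\<forall>j\<le>c - lo. - T j < (S k :: real))"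
  have [measurable]: "(\<lambda>z. argmax_upto (hi - c) (\<lambda>j. snd z j :: real))
      \<in> measurable ((\<Pi>\<^sub>M i\<in>UNIV. borel) \<Otimes>\<^sub>M (\<Pi>\<^sub>M i\<in>UNIV. borel)) (count_space UNIV)"
    by (rule measurable_argmax_upto) measurable
  have [measurable]: "(\<lambda>\<omega>. argmax_upto n (walk Y \<omega>)) \<in> measurable (iid H2) (count_space UNIV)" for n
    by (rule measurable_argmax_upto) measurable
  define Q where "Q x y \<longleftrightarrow> argmax_upto (hi - c) (walk Y x) = k
        \<and> (\<forall>j\<le>c - lo. walk (\<lambda>x. - Y x) y j < walk Y x k)" for x y
  have "(LINT x:{0..}|B_plus_inf Y H2 k. R_plus_inf (\<lambda>x. - Y x) H1 x)
      \<le> measure (iid H2 \<Otimes>\<^sub>M iid H1) {z \<in> space (iid H2 \<Otimes>\<^sub>M iid H1). Q (fst z) (snd z)}"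
    unfolding Q_def using H k by (intro integral_B_plus_inf_le) auto
  also have "\<dots> = measure (iid H1 \<Otimes>\<^sub>M iid H2) {z \<in> space (iid H1 \<Otimes>\<^sub>M iid H2). Q (snd z) (fst z)}"
    using H by (intro measure_pair_swap[symmetric] prob_space_iid) (auto simp: Q_def)
  also have "\<dots> = measure P {\<omega> \<in> space P. argmax_upto (hi - c) (\<lambda>j. walk Y (\<lambda>i. X i \<omega>) (c + j)) = k
        \<and> (\<forall>j\<le>c - lo. walk Y (\<lambda>i. X i \<omega>) (c - j) < walk Y (\<lambda>i. X i \<omega>) (c + k))}"
  proof (rule prob_eq_two_sided[OF P indep le H dist Y, where R = ?R, symmetric])
    show "Measurable.pred ((\<Pi>\<^sub>M i\<in>UNIV. borel) \<Otimes>\<^sub>M (\<Pi>\<^sub>M i\<in>UNIV. borel)) ?R"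
      unfolding case_prod_beta' by measurable
    show "argmax_upto (hi - c) (\<lambda>j. walk Y x (c + j)) = k \<and> (\<forall>j\<le>c - lo. walk Y x (c - j) < walk Y x (c + k)) \<longleftrightarrow>
      ?R (\<lambda>j. walk Y x c - walk Y x (c - min j (c - lo)), \<lambda>j. walk Y x (c + min j (hi - c)) - walk Y x c)" for x
    proof -
      have "argmax_upto (hi - c) (\<lambda>j. walk Y x (c + min j (hi - c)) - walk Y x c)
          = argmax_upto (hi - c) (\<lambda>j. walk Y x (c + j) - walk Y x c)"
        by (rule argmax_upto_cong) auto
      also have "\<dots> = argmax_upto (hi - c) (\<lambda>j. walk Y x (c + j))"
        by (rule argmax_upto_shift)
      finally show ?thesis
        using k by auto
    qed
    show "Q y x \<longleftrightarrow> ?R (\<lambda>j. walk Y x (min j (c - lo)), \<lambda>j. walk Y y (min j (hi - c)))" for x y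
    proof -
      have "argmax_upto (hi - c) (\<lambda>j. walk Y y (min j (hi - c))) = argmax_upto (hi - c) (walk Y y)"
        by (rule argmax_upto_cong) auto
      then show ?thesis
        using k by (auto simp: Q_def walk_uminus)
    qed
  qed
  finally show ?thesis .
qed

section \<open>Bounds for the local likelihood estimators\<close>

lemma b_tilde_eq: "b_tilde Y n x \<gamma> = \<gamma> + argmax_upto (n - \<gamma>) (\<lambda>i. walk Y x (\<gamma> + i))"
  by (simp add: b_tilde_def S_plus_def[abs_def] argmax_upto_shift)

lemma a_tilde_eq: "a_tilde Y x \<gamma> = \<gamma> - argmax_upto \<gamma> (\<lambda>i. - walk Y x (\<gamma> - i))"
  using argmax_upto_shift[of \<gamma> "\<lambda>i. - walk Y x (\<gamma> - i)" "- walk Y x \<gamma>"]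
  by (simp add: a_tilde_def S_minus_def[abs_def] argmin_upto_eq_argmax_upto add.commute)

lemma borel_measurable_loglik:
  assumes [measurable]: "f \<in> borel_measurable M" "g \<in> borel_measurable M"
  shows "loglik f g \<in> borel_measurable M"
  unfolding loglik_def[abs_def] by measurable

text \<open>With the starting point \<open>\<gamma> = b - k\<close> the estimator looks only at times after the maximum, so it
  returns \<open>\<gamma>\<close> itself, even if the maximum is attained again later.\<close>

lemma b_tilde_eq_before:
  assumes "k \<le> b" "b \<le> n"
    and k: "argmax_upto p (\<lambda>j. walk Y x (b - j)) = k"
    and less: "\<forall>j\<le>n - b. walk Y x (b + j) < walk Y x (b - k)"
  shows "b_tilde Y n x (b - k) = b - k"
proof -
  have k_less: "walk Y x (b - j) < walk Y x (b - k)" if "j < k" for j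
    using k that unfolding argmax_upto_eq_iff by blast
  have "walk Y x (b - k + i) \<le> walk Y x (b - k)" if "i \<le> n - (b - k)" for i
  proof (cases "i \<le> k")
    case True
    then have "b - k + i = b - (k - i)"
      using assms(1) by simp
    moreover have "walk Y x (b - (k - i)) \<le> walk Y x (b - k)"
    proof (cases "i = 0")
      case False
      then show ?thesis
        using k_less[of "k - i"] True by linarith
    qed simp
    ultimately show ?thesis
      by (simp only:)
  next
    case False
    then have "b - k + i = b + (i - k)" "i - k \<le> n - b"
      using that assms by auto
    then show ?thesis
      using less by (metis less_imp_le)
  qed
  then have "argmax_upto (n - (b - k)) (\<lambda>i. walk Y x (b - k + i)) = 0"
    unfolding argmax_upto_eq_iff by simp
  then show ?thesis
    by (simp add: b_tilde_eq)
qed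

text \<open>Likewise for \<open>\<gamma> = a + k\<close>, from where the estimator of \<open>a\<close> looks only at earlier times.\<close>

lemma a_tilde_eq_after:
  assumes k: "argmax_upto p (\<lambda>j. - walk Y x (a + j)) = k"
    and less: "\<forall>j\<le>a. - walk Y x (a - j) < - walk Y x (a + k)"
  shows "a_tilde Y x (a + k) = a + k"
proof -
  have k_less: "- walk Y x (a + j) < - walk Y x (a + k)" if "j < k" for j
    using k that unfolding argmax_upto_eq_iff by blast
  have "- walk Y x (a + k - i) \<le> - walk Y x (a + k)" if "i \<le> a + k" for i
  proof (cases "i \<le> k")
    case True
    then have "a + k - i = a + (k - i)"
      by simp
    moreover have "- walk Y x (a + (k - i)) \<le> - walk Y x (a + k)"
    proof (cases "i = 0")
      case False
      then show ?thesis
        using k_less[of "k - i"] True by linarith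
    qed simp
    ultimately show ?thesis
      by (simp only:)
  next
    case False
    then have "a + k - i = a - (i - k)" "i - k \<le> a"
      using that by auto
    then show ?thesis
      using less by (metis less_imp_le)
  qed
  then have "argmax_upto (a + k) (\<lambda>i. - walk Y x (a + k - i)) = 0"
    unfolding argmax_upto_eq_iff by simp
  then show ?thesis
    by (simp add: a_tilde_eq)
qed

text \<open>The search from \<open>\<gamma> = a + 1\<close> runs backwards, so its first minimiser is the last minimum of the walk,
  as in the tie-breaking rule for the reversed walk.\<close>

lemma a_tilde_Suc_eq:
  assumes k: "argmax_upto a (\<lambda>j. - walk Y x (a - j)) = k"
    and less: "- walk Y x (Suc a) < - walk Y x (a - k)"
  shows "a_tilde Y x (Suc a) = a - k"
proof -
  have m: "k \<le> a" "\<And>j. j < k \<Longrightarrow> - walk Y x (a - j) < - walk Y x (a - k)"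
    "\<And>j. k < j \<Longrightarrow> j \<le> a \<Longrightarrow> - walk Y x (a - j) \<le> - walk Y x (a - k)"
    using k unfolding argmax_upto_eq_iff by blast+
  have "- walk Y x (Suc a - i) < - walk Y x (Suc a - Suc k)" if "i < Suc k" for i
    using that less m(2)[of "i - 1"] by (cases i) simp_all
  moreover have "- walk Y x (Suc a - i) \<le> - walk Y x (Suc a - Suc k)" if "Suc k < i" "i \<le> Suc a" for i
    using that m(3)[of "i - 1"] by (cases i) simp_all
  ultimately have "argmax_upto (Suc a) (\<lambda>i. - walk Y x (Suc a - i)) = Suc k"
    unfolding argmax_upto_eq_iff using m(1) by blast
  then show ?thesis
    by (simp add: a_tilde_eq)
qed

theorem proposition2p2:
  fixes \<mu> F G :: "'a measure" and f g Y :: "'a \<Rightarrow> real"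
    and P :: "'w measure" and X :: "nat \<Rightarrow> 'w \<Rightarrow> 'a"
    and a b n :: nat
  assumes f: "f \<in> borel_measurable \<mu>" "\<And>x. 0 \<le> f x"
    and g: "g \<in> borel_measurable \<mu>" "\<And>x. 0 \<le> g x"
    and F: "prob_space F" "F = density \<mu> (\<lambda>x. ennreal (f x))"
    and G: "prob_space G" "G = density \<mu> (\<lambda>x. ennreal (g x))"
    and Y: "Y = loglik f g"
    and P: "prob_space P"
    and indep: "prob_space.indep_vars P (\<lambda>_. \<mu>) X {1..n}"
    and dist: "\<And>i. i \<in> {1..n} \<Longrightarrow> distr P \<mu> (X i) = (if a < i \<and> i \<le> b then G else F)"
    and ab: "a < b" "b \<le> n"
  shows
    "(\<forall>r::int. int a - int b < r \<and> r \<le> int n - int b \<longrightarrow>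
       (SUP \<gamma>\<in>{a<..b}. measure P {\<omega> \<in> space P. int (b_tilde Y n (\<lambda>i. X i \<omega>) \<gamma>) = int b + r})
       \<ge> (if r = 0 then zero_bound Y F G
          else if r < 0
            then LINT x:{0..}|B_minus_inf Y G (nat (- r)). R_plus_inf Y F x
            else LINT x:{0..}|B_plus_inf Y F (nat r). R_minus_inf Y G x))
   \<and> (\<forall>l::int. - int a \<le> l \<and> l \<le> int b - int a \<longrightarrow>
       (SUP \<gamma>\<in>{a<..b}. measure P {\<omega> \<in> space P. int (a_tilde Y (\<lambda>i. X i \<omega>) \<gamma>) = int a + l})
       \<ge> (if l = 0 then zero_bound Y F G
          else if l < 0
            then LINT x:{0..}|B_plus_inf Y F (nat (- l)). R_minus_inf Y G x
            else LINT x:{0..}|B_minus_inf Y G (nat l). R_plus_inf Y F x))"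
proof -
  have YM: "Y \<in> borel_measurable \<mu>"
    unfolding Y using f(1) g(1) by (rule borel_measurable_loglik)
  have sets_FG: "sets F = sets \<mu>" "sets G = sets \<mu>"
    by (simp_all add: F(2) G(2))
  have YFG: "Y \<in> borel_measurable F" "Y \<in> borel_measurable G"
    using YM measurable_cong_sets[OF sets_FG(1) refl] measurable_cong_sets[OF sets_FG(2) refl] by blast+
  interpret P: prob_space P by fact
  define S where "S \<omega> = walk Y (\<lambda>i. X i \<omega>)" for \<omega>
  have X: "X i \<in> measurable P \<mu>" if "i \<in> {1..n}" for i
    using indep that by (simp add: P.indep_vars_def)
  have S_meas: "(\<lambda>\<omega>. S \<omega> t) \<in> borel_measurable P" if "t \<le> n" for t
    unfolding S_def walk_def using that
    by (intro borel_measurable_sum measurable_compose[OF X YM]) auto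
  have b_meas: "{\<omega> \<in> space P. int (b_tilde Y n (\<lambda>i. X i \<omega>) \<gamma>) = m} \<in> sets P" if "\<gamma> \<le> n" for \<gamma> m
  proof -
    have [measurable]: "(\<lambda>\<omega>. argmax_upto (n - \<gamma>) (\<lambda>i. S \<omega> (\<gamma> + i))) \<in> measurable P (count_space UNIV)"
      using that by (intro measurable_argmax_upto S_meas) auto
    show ?thesis
      unfolding b_tilde_eq S_def[symmetric] by measurable
  qed
  have a_meas: "{\<omega> \<in> space P. int (a_tilde Y (\<lambda>i. X i \<omega>) \<gamma>) = m} \<in> sets P" if "\<gamma> \<le> n" for \<gamma> m
  proof -
    have [measurable]: "(\<lambda>\<omega>. argmax_upto \<gamma> (\<lambda>i. - S \<omega> (\<gamma> - i))) \<in> measurable P (count_space UNIV)"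
      using that by (intro measurable_argmax_upto borel_measurable_uminus S_meas) auto
    show ?thesis
      unfolding a_tilde_eq S_def[symmetric] by measurable
  qed
  have b_SUP: "v \<le> (SUP \<gamma>\<in>{a<..b}. measure P {\<omega> \<in> space P. int (b_tilde Y n (\<lambda>i. X i \<omega>) \<gamma>) = m})"
    if "\<gamma> \<in> {a<..b}" "v \<le> measure P {\<omega> \<in> space P. E \<omega>}" "\<And>\<omega>. E \<omega> \<Longrightarrow> int (b_tilde Y n (\<lambda>i. X i \<omega>) \<gamma>) = m"
    for v \<gamma> E m
  proof (rule cSUP_upper2[OF _ that(1)])
    show "v \<le> measure P {\<omega> \<in> space P. int (b_tilde Y n (\<lambda>i. X i \<omega>) \<gamma>) = m}"
      using that ab by (intro order_trans[OF that(2)] P.finite_measure_mono b_meas) auto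
  qed auto
  have a_SUP: "v \<le> (SUP \<gamma>\<in>{a<..b}. measure P {\<omega> \<in> space P. int (a_tilde Y (\<lambda>i. X i \<omega>) \<gamma>) = m})"
    if "\<gamma> \<in> {a<..b}" "v \<le> measure P {\<omega> \<in> space P. E \<omega>}" "\<And>\<omega>. E \<omega> \<Longrightarrow> int (a_tilde Y (\<lambda>i. X i \<omega>) \<gamma>) = m"
    for v \<gamma> E m
  proof (rule cSUP_upper2[OF _ that(1)])
    show "v \<le> measure P {\<omega> \<in> space P. int (a_tilde Y (\<lambda>i. X i \<omega>) \<gamma>) = m}"
      using that ab by (intro order_trans[OF that(2)] P.finite_measure_mono a_meas) auto
  qed auto

  have sub: "{a<..n} \<subseteq> {1..n}" "{0<..b} \<subseteq> {1..n}"
    using ab by auto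
  have right: "P.indep_vars (\<lambda>_. \<mu>) X {a<..n}" "a \<le> b" "b \<le> n" "a < n"
      "\<And>i. i \<in> {a<..n} \<Longrightarrow> distr P \<mu> (X i) = (if i \<le> b then G else F)"
    using P.indep_vars_subset[OF indep sub(1)] ab dist by auto
  have left: "P.indep_vars (\<lambda>_. \<mu>) X {0<..b}" "0 \<le> a" "a \<le> b" "0 < b"
      "\<And>i. i \<in> {0<..b} \<Longrightarrow> distr P \<mu> (X i) = (if i \<le> a then F else G)"
    using P.indep_vars_subset[OF indep sub(2)] ab dist by auto
  \<comment> \<open>Around \<open>b\<close> the observations after \<open>a\<close> are used, around \<open>a\<close> those up to \<open>b\<close>: on each range there is
    a single change of distribution.\<close>
  note right_setup = P right(1-4) G(1) F(1) sets_FG(2,1) right(5)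
  note left_setup = P left(1-4) F(1) G(1) sets_FG left(5)
  have YM': "(\<lambda>x. - Y x) \<in> borel_measurable \<mu>"
    using YM by (rule borel_measurable_uminus)
  have zero: "zero_bound Y F G \<le> stay {..0} Y F m * stay {0<..} Y G k" for m k
    using F(1) G(1) YFG by (rule zero_bound_le)

  have b_part: "(if r = 0 then zero_bound Y F G
          else if r < 0
            then LINT x:{0..}|B_minus_inf Y G (nat (- r)). R_plus_inf Y F x
            else LINT x:{0..}|B_plus_inf Y F (nat r). R_minus_inf Y G x)
      \<le> (SUP \<gamma>\<in>{a<..b}. measure P {\<omega> \<in> space P. int (b_tilde Y n (\<lambda>i. X i \<omega>) \<gamma>) = int b + r})"
    (is "?L \<le> ?S") if r: "int a - int b < r" "r \<le> int n - int b" for r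
  proof -
    consider "r = 0" | "r < 0" | "0 < r" by linarith
    then show ?thesis
    proof cases
      case 1
      have "zero_bound Y F G \<le> ?S"
      proof (rule b_SUP)
        show "b \<in> {a<..b}" using ab by simp
        show "zero_bound Y F G \<le> measure P {\<omega> \<in> space P.
            (\<forall>j\<in>{1..b - a}. walk Y (\<lambda>i. X i \<omega>) b - walk Y (\<lambda>i. X i \<omega>) (b - j) \<in> {0<..})
          \<and> (\<forall>j\<in>{1..n - b}. walk Y (\<lambda>i. X i \<omega>) (b + j) - walk Y (\<lambda>i. X i \<omega>) b \<in> {..0})}"
          using zero[of "n - b" "b - a"]
          by (subst prob_two_sided_stay[OF right_setup YM]) (auto simp: mult.commute)
        show "int (b_tilde Y n (\<lambda>i. X i \<omega>) b) = int b + r"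
          if "(\<forall>j\<in>{1..b - a}. walk Y (\<lambda>i. X i \<omega>) b - walk Y (\<lambda>i. X i \<omega>) (b - j) \<in> {0<..})
          \<and> (\<forall>j\<in>{1..n - b}. walk Y (\<lambda>i. X i \<omega>) (b + j) - walk Y (\<lambda>i. X i \<omega>) b \<in> {..0})" for \<omega>
        proof -
          have "argmax_upto (n - b) (\<lambda>i. walk Y (\<lambda>i. X i \<omega>) (b + i)) = 0"
            using that unfolding argmax_upto_eq_iff by simp
          then show ?thesis
            using 1 by (simp add: b_tilde_eq)
        qed
      qed
      then show ?thesis using 1 by simp
    next
      case 2
      define k where "k = nat (- r)"
      have k: "0 < k" "k < b - a" "r = - int k"
        using 2 r by (auto simp: k_def)
      then have k_le: "k \<le> b - a"
        by simp
      have "(LINT x:{0..}|B_plus_inf (\<lambda>x. - Y x) G k. R_plus_inf Y F x) \<le> ?S"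
      proof (rule b_SUP)
        show "b - k \<in> {a<..b}" using k by auto
        show "int (b_tilde Y n (\<lambda>i. X i \<omega>) (b - k)) = int b + r"
          if "argmax_upto (b - a) (\<lambda>j. walk Y (\<lambda>i. X i \<omega>) (b - j)) = k
            \<and> (\<forall>j\<le>n - b. walk Y (\<lambda>i. X i \<omega>) (b + j) < walk Y (\<lambda>i. X i \<omega>) (b - k))" for \<omega>
        proof -
          have "b_tilde Y n (\<lambda>i. X i \<omega>) (b - k) = b - k"
            using that k ab by (intro b_tilde_eq_before[where p = "b - a"]) auto
          then show ?thesis
            using k by simp
        qed
      qed (rule integral_le_prob_argmax_backward[OF right_setup YM k_le])
      then show ?thesis
        using 2 by (simp add: k_def B_minus_inf_eq)
    next
      case 3
      define k where "k = nat r"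
      have k: "k \<le> n - b" "r = int k"
        using 3 r by (auto simp: k_def)
      have "(LINT x:{0..}|B_plus_inf Y F k. R_plus_inf (\<lambda>x. - Y x) G x) \<le> ?S"
      proof (rule b_SUP)
        show "b \<in> {a<..b}" using ab by simp
        show "int (b_tilde Y n (\<lambda>i. X i \<omega>) b) = int b + r"
          if "argmax_upto (n - b) (\<lambda>j. walk Y (\<lambda>i. X i \<omega>) (b + j)) = k
            \<and> (\<forall>j\<le>b - a. walk Y (\<lambda>i. X i \<omega>) (b - j) < walk Y (\<lambda>i. X i \<omega>) (b + k))" for \<omega>
          using that k by (simp add: b_tilde_eq)
      qed (rule integral_le_prob_argmax_forward[OF right_setup YM k(1)])
      then show ?thesis
        using 3 by (simp add: k_def R_minus_inf_eq)
    qed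
  qed

  have a_part: "(if l = 0 then zero_bound Y F G
          else if l < 0
            then LINT x:{0..}|B_plus_inf Y F (nat (- l)). R_minus_inf Y G x
            else LINT x:{0..}|B_minus_inf Y G (nat l). R_plus_inf Y F x)
      \<le> (SUP \<gamma>\<in>{a<..b}. measure P {\<omega> \<in> space P. int (a_tilde Y (\<lambda>i. X i \<omega>) \<gamma>) = int a + l})"
    (is "?L \<le> ?S") if l: "- int a \<le> l" "l \<le> int b - int a" for l
  proof -
    consider "l = 0" | "l < 0" | "0 < l" by linarith
    then show ?thesis
    proof cases
      case 1
      have "zero_bound Y F G \<le> ?S"
      proof (rule a_SUP)
        show "Suc a \<in> {a<..b}" using ab by simp
        show "zero_bound Y F G \<le> measure P {\<omega> \<in> space P.
            (\<forall>j\<in>{1..a - 0}. walk Y (\<lambda>i. X i \<omega>) a - walk Y (\<lambda>i. X i \<omega>) (a - j) \<in> {..0})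
          \<and> (\<forall>j\<in>{1..b - a}. walk Y (\<lambda>i. X i \<omega>) (a + j) - walk Y (\<lambda>i. X i \<omega>) a \<in> {0<..})}"
          using zero[of a "b - a"] by (subst prob_two_sided_stay[OF left_setup YM]) auto
        show "int (a_tilde Y (\<lambda>i. X i \<omega>) (Suc a)) = int a + l"
          if "(\<forall>j\<in>{1..a - 0}. walk Y (\<lambda>i. X i \<omega>) a - walk Y (\<lambda>i. X i \<omega>) (a - j) \<in> {..0})
          \<and> (\<forall>j\<in>{1..b - a}. walk Y (\<lambda>i. X i \<omega>) (a + j) - walk Y (\<lambda>i. X i \<omega>) a \<in> {0<..})" for \<omega>
        proof -
          have "argmax_upto a (\<lambda>j. - walk Y (\<lambda>i. X i \<omega>) (a - j)) = 0"
            using that unfolding argmax_upto_eq_iff by simp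
          moreover have "- walk Y (\<lambda>i. X i \<omega>) (Suc a) < - walk Y (\<lambda>i. X i \<omega>) (a - 0)"
            using bspec[OF conjunct2[OF that], of 1] ab by simp
          ultimately have "a_tilde Y (\<lambda>i. X i \<omega>) (Suc a) = a - 0"
            by (rule a_tilde_Suc_eq)
          then show ?thesis
            using 1 by simp
        qed
      qed
      then show ?thesis using 1 by simp
    next
      case 2
      define k where "k = nat (- l)"
      have k: "0 < k" "k \<le> a" "l = - int k"
        using 2 l by (auto simp: k_def)
      then have k_le: "k \<le> a - 0"
        by simp
      have "(LINT x:{0..}|B_plus_inf (\<lambda>x. - (- Y x)) F k. R_plus_inf (\<lambda>x. - Y x) G x) \<le> ?S"
      proof (rule a_SUP)
        show "Suc a \<in> {a<..b}" using ab by simp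
        show "int (a_tilde Y (\<lambda>i. X i \<omega>) (Suc a)) = int a + l"
          if "argmax_upto (a - 0) (\<lambda>j. walk (\<lambda>x. - Y x) (\<lambda>i. X i \<omega>) (a - j)) = k
            \<and> (\<forall>j\<le>b - a. walk (\<lambda>x. - Y x) (\<lambda>i. X i \<omega>) (a + j) < walk (\<lambda>x. - Y x) (\<lambda>i. X i \<omega>) (a - k))" for \<omega>
        proof -
          have "a_tilde Y (\<lambda>i. X i \<omega>) (Suc a) = a - k"
          proof (rule a_tilde_Suc_eq)
            show "- walk Y (\<lambda>i. X i \<omega>) (Suc a) < - walk Y (\<lambda>i. X i \<omega>) (a - k)"
              using spec[OF conjunct2[OF that], of 1] ab by (simp add: walk_uminus)
          qed (use that in \<open>simp add: walk_uminus\<close>)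
          then show ?thesis
            using k by simp
        qed
      qed (rule integral_le_prob_argmax_backward[OF left_setup YM' k_le])
      then show ?thesis
        using 2 by (simp add: k_def R_minus_inf_eq)
    next
      case 3
      define k where "k = nat l"
      have k: "0 < k" "k \<le> b - a" "l = int k"
        using 3 l by (auto simp: k_def)
      have "(LINT x:{0..}|B_plus_inf (\<lambda>x. - Y x) G k. R_plus_inf (\<lambda>x. - (- Y x)) F x) \<le> ?S"
      proof (rule a_SUP)
        show "a + k \<in> {a<..b}" using k ab by auto
        show "int (a_tilde Y (\<lambda>i. X i \<omega>) (a + k)) = int a + l"
          if "argmax_upto (b - a) (\<lambda>j. walk (\<lambda>x. - Y x) (\<lambda>i. X i \<omega>) (a + j)) = k
            \<and> (\<forall>j\<le>a - 0. walk (\<lambda>x. - Y x) (\<lambda>i. X i \<omega>) (a - j) < walk (\<lambda>x. - Y x) (\<lambda>i. X i \<omega>) (a + k))" for \<omega>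
        proof -
          have "a_tilde Y (\<lambda>i. X i \<omega>) (a + k) = a + k"
            by (rule a_tilde_eq_after[where p = "b - a"]) (use that in \<open>simp_all add: walk_uminus\<close>)
          then show ?thesis
            using k by simp
        qed
      qed (rule integral_le_prob_argmax_forward[OF left_setup YM' k(2)])
      then show ?thesis
        using 3 by (simp add: k_def B_minus_inf_eq)
    qed
  qed
  show ?thesis
    using a_part b_part by blast
qed

end
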